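(* Let $k,\ell$ be integers with $k\ge 1$ and $0\le \ell\le k+1$, let $\Gamma$ be a group, let $(G,\psi)$ be a $\Gamma$-labeled graph, and let $\alpha:2^{\Gamma}\to\{0,1,\dots,\ell\}$ be a normalized polymatroidal function such that $\alpha(\Gamma')\le k$ for every subgroup $\Gamma'\subseteq\Gamma$ with $\Gamma'\simeq \mathbb{Z}_2$. Define $f_\alpha:\mathcal{C}(G)\to\mathbb{Z}$ by $$f_\alpha(F)=k|V(F)|-\ell+\begin{cases}\min\{\tilde\alpha(F),k\} & \text{if } F \text{ is near-balanced},\\ \tilde\alpha(F) & \text{otherwise.}\end{cases}$$ Then the set $\mathcal{I}_\alpha(G)=\{I\subseteq E(G) : |F|\le f_\alpha(F)\ \text{for all } F\in\mathcal{C}(G)\cap 2^I\}$ is the family of independent sets of a matroid on $E(G)$.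
   Context: Graphs are finite and may have loops and parallel edges. A $\Gamma$-labeled graph $(G,\psi)$ is a directed graph $G=(V,E)$ with a map $\psi:E\to\Gamma$. The orientation is only for reference: one may reverse any edge (including a loop), replacing its label $g$ by $g^{-1}$. Connectivity, walks and cycles refer to the underlying undirected graph. For $F\subseteq E$, $V(F)$ is the set of vertices incident to edges of $F$; $\mathcal{C}(G)$ is the set of nonempty connected edge sets $F\subseteq E$ (i.e. $(V(F),F)$ is connected). The gain $\psi(W)$ of a walk $W=v_0,e_1,v_1,\dots,e_m,v_m$ is $\psi(e_1)^{\sigma(e_1)}\cdots\psi(e_m)^{\sigma(e_m)}$, where $\sigma(e_i)=1$ if $e_i$ is traversed forward and $-1$ otherwise. For $F\in\mathcal{C}(G)$ and $v\in V(F)$, $\langle F\rangle_{v,\psi}$ is the subgroup of $\Gamma$ generated by the gains of all closed walks starting at $v$ using only edges of $F$; for different $v\in V(F)$ these subgroups are conjugate. An edge set is unbalanced if it contains a cycle (loops count as cycles) with non-identity gain, and balanced otherwise; a loop is balanced iff its label is $1_\Gamma$. Let $v$ be a vertex and $\{E_1,E_2\}$ a bipartition (parts may be empty) of the set of non-loop edges incident to $v$. The split of $(G,\psi)$ at $v$ with respect to $\{E_1,E_2\}$ is the $\Gamma$-labeled graph obtained by replacing $v$ by two vertices $v_1,v_2$ such that $v_i$ is incident to the edges in $E_i$ ($i=1,2$), each balanced loop at $v$ becomes a loop at $v_1$, and each unbalanced loop $e$ at $v$ becomes an arc from $v_1$ to $v_2$ keeping its label (since loops can be reversed, the label of this arc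 may be chosen to be either $\psi(e)$ or $\psi(e)^{-1}$). All labels are otherwise kept. $F\in\mathcal{C}(G)$ is near-balanced if it is not balanced and there is a split of $(G,\psi)$ in which $F$ becomes a balanced set. For $S\subseteq\Gamma$, $\langle S\rangle$ is the subgroup generated by $S$. A function $\alpha:2^\Gamma\to\mathbb{Z}$ is polymatroidal if: (c1) $\alpha(\emptyset)=0$; (c2) $\alpha(X)+\alpha(Y)\ge\alpha(X\cup Y)+\alpha(X\cap Y)$ for all $X,Y\subseteq\Gamma$; (c3) $\alpha(X)\le\alpha(Y)$ for $X\subseteq Y\subseteq\Gamma$; (c4) $\alpha(\gamma X\gamma^{-1})=\alpha(X)$ for $X\subseteq\Gamma$, $\gamma\in\Gamma$; (c5) $\alpha(\langle X\rangle)=\alpha(X)$ for $X\subseteq\Gamma$. It is normalized if moreover $\alpha(\{1_\Gamma\})=0$ and $\alpha(\{g\})\ne 0$ for every $g\ne 1_\Gamma$. For $F\in\mathcal{C}(G)$, $\tilde\alpha(F):=\alpha(\langle F\rangle_{v,\psi})$ for any $v\in V(F)$ (independent of $v$ by (c4)). *)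

theory Defs
  imports
    "HOL-Algebra.Coset"
    "HOL-Algebra.Generated_Groups"
    "HOL-Algebra.Elementary_Groups"
    "Graph_Theory.Digraph_Component"
    "Graph_Theory.Arc_Walk"
begin

section \<open>Matroids\<close>

definition matroid_indep :: "'e set \<Rightarrow> 'e set set \<Rightarrow> bool" where
  "matroid_indep E \<I> \<longleftrightarrow>
     finite E \<and> \<I> \<subseteq> Pow E \<and> {} \<in> \<I> \<and>
     (\<forall>X\<in>\<I>. \<forall>Y. Y \<subseteq> X \<longrightarrow> Y \<in> \<I>) \<and>
     (\<forall>X\<in>\<I>. \<forall>Y\<in>\<I>. card X < card Y \<longrightarrow> (\<exists>e\<in>Y - X. insert e X \<in> \<I>))"


section \<open>Edge sets and undirected walks\<close>

definition edge_verts :: "('a, 'b) pre_digraph \<Rightarrow> 'b set \<Rightarrow> 'a set" where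
  "edge_verts G F = tail G ` F \<union> head G ` F"

definition edge_subgraph :: "('a, 'b) pre_digraph \<Rightarrow> 'b set \<Rightarrow> ('a, 'b) pre_digraph" where
  "edge_subgraph G F = \<lparr>verts = edge_verts G F, arcs = F, tail = tail G, head = head G\<rparr>"

definition conn_sets :: "('a, 'b) pre_digraph \<Rightarrow> 'b set set" where
  "conn_sets G = {F. F \<subseteq> arcs G \<and> F \<noteq> {} \<and> Digraph_Component.connected (edge_subgraph G F)}"

text \<open>
  Every edge e is replaced by two arcs, (e, True) for its forward and (e, False) for
  its backward traversal. The directed walks of the resulting digraph are the walks of the
  underlying undirected graph; in particular a loop can be traversed both ways.
\<close>

definition bidir :: "('a, 'b) pre_digraph \<Rightarrow> ('a, 'b \<times> bool) pre_digraph" where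
  "bidir G = \<lparr>verts = verts G, arcs = arcs G \<times> UNIV,
     tail = (\<lambda>(e, fwd). if fwd then tail G e else head G e),
     head = (\<lambda>(e, fwd). if fwd then head G e else tail G e)\<rparr>"

definition walk_in :: "('a, 'b) pre_digraph \<Rightarrow> 'b set \<Rightarrow> 'a \<Rightarrow> ('b \<times> bool) list \<Rightarrow> 'a \<Rightarrow> bool" where
  "walk_in G F u p v \<longleftrightarrow> pre_digraph.awalk (bidir (edge_subgraph G F)) u p v"

text \<open>
  Distinctness of the underlying edges excludes going back and forth along one non-loop edge,
  but admits the cycles formed by two parallel edges.
\<close>

definition cycle_in :: "('a, 'b) pre_digraph \<Rightarrow> 'b set \<Rightarrow> ('b \<times> bool) list \<Rightarrow> bool" where
  "cycle_in G F p \<longleftrightarrow>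
     pre_digraph.cycle (bidir (edge_subgraph G F)) p \<and> distinct (map fst p)"


section \<open>Group-labeled graphs\<close>

locale labeled_graph = group \<Gamma> + fin_digraph G
  for \<Gamma> :: "('g, 'm) monoid_scheme" and G :: "('a, 'b) pre_digraph" +
  fixes \<psi> :: "'b \<Rightarrow> 'g"
  assumes label_closed: "e \<in> arcs G \<Longrightarrow> \<psi> e \<in> carrier \<Gamma>"

definition gain :: "('g, 'm) monoid_scheme \<Rightarrow> ('b \<Rightarrow> 'g) \<Rightarrow> ('b \<times> bool) list \<Rightarrow> 'g" where
  "gain \<Gamma> \<psi> p =
     foldr (\<otimes>\<^bsub>\<Gamma>\<^esub>) (map (\<lambda>(e, fwd). if fwd then \<psi> e else inv\<^bsub>\<Gamma>\<^esub> (\<psi> e)) p) \<one>\<^bsub>\<Gamma>\<^esub>"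

definition gain_group ::
  "('g, 'm) monoid_scheme \<Rightarrow> ('a, 'b) pre_digraph \<Rightarrow> ('b \<Rightarrow> 'g) \<Rightarrow> 'b set \<Rightarrow> 'a \<Rightarrow> 'g set" where
  "gain_group \<Gamma> G \<psi> F v = generate \<Gamma> {gain \<Gamma> \<psi> p | p. walk_in G F v p v}"

definition balanced ::
  "('g, 'm) monoid_scheme \<Rightarrow> ('a, 'b) pre_digraph \<Rightarrow> ('b \<Rightarrow> 'g) \<Rightarrow> 'b set \<Rightarrow> bool" where
  "balanced \<Gamma> G \<psi> F \<longleftrightarrow> \<not> (\<exists>p. cycle_in G F p \<and> gain \<Gamma> \<psi> p \<noteq> \<one>\<^bsub>\<Gamma>\<^esub>)"


section \<open>Splits and near-balanced sets\<close>

definition loops_at :: "('a, 'b) pre_digraph \<Rightarrow> 'a \<Rightarrow> 'b set" where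
  "loops_at G v = {e \<in> arcs G. tail G e = v \<and> head G e = v}"

definition nonloops_at :: "('a, 'b) pre_digraph \<Rightarrow> 'a \<Rightarrow> 'b set" where
  "nonloops_at G v = {e \<in> arcs G. tail G e \<noteq> head G e \<and> (tail G e = v \<or> head G e = v)}"

definition unbalanced_loops_at ::
  "('g, 'm) monoid_scheme \<Rightarrow> ('a, 'b) pre_digraph \<Rightarrow> ('b \<Rightarrow> 'g) \<Rightarrow> 'a \<Rightarrow> 'b set" where
  "unbalanced_loops_at \<Gamma> G \<psi> v = {e \<in> loops_at G v. \<psi> e \<noteq> \<one>\<^bsub>\<Gamma>\<^esub>}"

datatype 'a split_vertex = Old 'a | Split1 | Split2

definition split_end :: "'a \<Rightarrow> 'b set \<Rightarrow> 'b \<Rightarrow> 'a \<Rightarrow> 'a split_vertex" where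
  "split_end v E1 e u = (if u \<noteq> v then Old u else if e \<in> E1 then Split1 else Split2)"

text \<open>
  In the split at v the set E1 is one part of the bipartition of the non-loop edges at v, the
  other part being its complement in \<open>nonloops_at G v\<close>.
\<close>

definition split_graph ::
  "('g, 'm) monoid_scheme \<Rightarrow> ('a, 'b) pre_digraph \<Rightarrow> ('b \<Rightarrow> 'g) \<Rightarrow> 'a \<Rightarrow> 'b set \<Rightarrow>
     ('a split_vertex, 'b) pre_digraph" where
  "split_graph \<Gamma> G \<psi> v E1 =
     \<lparr>verts = Old ` (verts G - {v}) \<union> {Split1, Split2},
      arcs = arcs G,
      tail = (\<lambda>e. if e \<in> loops_at G v then Split1 else split_end v E1 e (tail G e)),
      head = (\<lambda>e. if e \<in> unbalanced_loops_at \<Gamma> G \<psi> v then Split2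
                   else if e \<in> loops_at G v then Split1
                   else split_end v E1 e (head G e))\<rparr>"

text \<open>
  R is the set of unbalanced loops at v that are reversed before splitting, i.e. that become arcs
  from \<^term>\<open>Split1\<close> to \<^term>\<open>Split2\<close> carrying the inverse label; the choice is made separately
  for each loop.
\<close>

definition split_label :: "('g, 'm) monoid_scheme \<Rightarrow> ('b \<Rightarrow> 'g) \<Rightarrow> 'b set \<Rightarrow> 'b \<Rightarrow> 'g" where
  "split_label \<Gamma> \<psi> R e = (if e \<in> R then inv\<^bsub>\<Gamma>\<^esub> (\<psi> e) else \<psi> e)"

definition near_balanced ::
  "('g, 'm) monoid_scheme \<Rightarrow> ('a, 'b) pre_digraph \<Rightarrow> ('b \<Rightarrow> 'g) \<Rightarrow> 'b set \<Rightarrow> bool" where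
  "near_balanced \<Gamma> G \<psi> F \<longleftrightarrow>
     F \<in> conn_sets G \<and> \<not> balanced \<Gamma> G \<psi> F \<and>
     (\<exists>v\<in>verts G. \<exists>E1 R. E1 \<subseteq> nonloops_at G v \<and> R \<subseteq> unbalanced_loops_at \<Gamma> G \<psi> v \<and>
        balanced \<Gamma> (split_graph \<Gamma> G \<psi> v E1) (split_label \<Gamma> \<psi> R) F)"


section \<open>Polymatroidal functions and the induced count\<close>

definition polymatroidal :: "('g, 'm) monoid_scheme \<Rightarrow> ('g set \<Rightarrow> int) \<Rightarrow> bool" where
  "polymatroidal \<Gamma> \<alpha> \<longleftrightarrow>
     \<alpha> {} = 0 \<and>
     (\<forall>X Y. X \<subseteq> carrier \<Gamma> \<and> Y \<subseteq> carrier \<Gamma> \<longrightarrow> \<alpha> X + \<alpha> Y \<ge> \<alpha> (X \<union> Y) + \<alpha> (X \<inter> Y)) \<and>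
     (\<forall>X Y. X \<subseteq> Y \<and> Y \<subseteq> carrier \<Gamma> \<longrightarrow> \<alpha> X \<le> \<alpha> Y) \<and>
     (\<forall>X g. X \<subseteq> carrier \<Gamma> \<and> g \<in> carrier \<Gamma> \<longrightarrow>
        \<alpha> ((g <#\<^bsub>\<Gamma>\<^esub> X) #>\<^bsub>\<Gamma>\<^esub> inv\<^bsub>\<Gamma>\<^esub> g) = \<alpha> X) \<and>
     (\<forall>X. X \<subseteq> carrier \<Gamma> \<longrightarrow> \<alpha> (generate \<Gamma> X) = \<alpha> X)"

definition normalized :: "('g, 'm) monoid_scheme \<Rightarrow> ('g set \<Rightarrow> int) \<Rightarrow> bool" where
  "normalized \<Gamma> \<alpha> \<longleftrightarrow>
     \<alpha> {\<one>\<^bsub>\<Gamma>\<^esub>} = 0 \<and> (\<forall>g\<in>carrier \<Gamma>. g \<noteq> \<one>\<^bsub>\<Gamma>\<^esub> \<longrightarrow> \<alpha> {g} \<noteq> 0)"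

text \<open>
  For connected F and polymatroidal \<open>\<alpha>\<close> the value does not depend on the chosen vertex, since the
  groups at different vertices are conjugate.
\<close>

definition alpha_tilde ::
  "('g, 'm) monoid_scheme \<Rightarrow> ('a, 'b) pre_digraph \<Rightarrow> ('b \<Rightarrow> 'g) \<Rightarrow> ('g set \<Rightarrow> int) \<Rightarrow> 'b set \<Rightarrow> int" where
  "alpha_tilde \<Gamma> G \<psi> \<alpha> F = \<alpha> (gain_group \<Gamma> G \<psi> F (SOME v. v \<in> edge_verts G F))"

definition f_alpha ::
  "('g, 'm) monoid_scheme \<Rightarrow> ('a, 'b) pre_digraph \<Rightarrow> ('b \<Rightarrow> 'g) \<Rightarrow> ('g set \<Rightarrow> int) \<Rightarrow>
     int \<Rightarrow> int \<Rightarrow> 'b set \<Rightarrow> int" where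
  "f_alpha \<Gamma> G \<psi> \<alpha> k l F =
     k * int (card (edge_verts G F)) - l +
     (if near_balanced \<Gamma> G \<psi> F then min (alpha_tilde \<Gamma> G \<psi> \<alpha> F) k
      else alpha_tilde \<Gamma> G \<psi> \<alpha> F)"

definition indep_alpha ::
  "('g, 'm) monoid_scheme \<Rightarrow> ('a, 'b) pre_digraph \<Rightarrow> ('b \<Rightarrow> 'g) \<Rightarrow> ('g set \<Rightarrow> int) \<Rightarrow>
     int \<Rightarrow> int \<Rightarrow> 'b set set" where
  "indep_alpha \<Gamma> G \<psi> \<alpha> k l =
     {I. I \<subseteq> arcs G \<and> (\<forall>F \<in> conn_sets G \<inter> Pow I. int (card F) \<le> f_alpha \<Gamma> G \<psi> \<alpha> k l F)}"

end

theory Submission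
  imports Defs "HOL-Algebra.Group_Action"
begin

text \<open>
  In \<open>f F = k * card (V F) - l + capped_alpha F\<close> the last summand is \<open>\<alpha>\<close> of the gain group of F, capped at k
  if F is near-balanced. Exchange follows from uncrossing. For an independent set I call a connected
  set D tight if I has at least \<open>f D\<close> edges in D. If unions of intersecting tight sets are tight, then the
  maximal tight sets are disjoint. For an independent set J none of whose edges can be added to I, they
  cover the edges of J outside I. Since J has at most \<open>f D\<close> edges in each of them, J is not larger than I
  (\<open>card_le_of_uncrossing_cover\<close>, \<open>indep_exchange\<close>).

  So everything rests on the lemma \<open>uncross\<close>: for intersecting connected sets D1 and D2, the number of
  edges of I in their intersection X is at most \<open>f D1 + f D2 - f (D1 \<union> D2)\<close>. If X is disconnected or misses a
  common vertex, this is a count over the components of X, with one exception: two balanced sets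
  that share one vertex outside of X, in which case their union can be made balanced by splitting that
  vertex. If X is connected and contains all common vertices, the uncapped value is submodular, because
  the gain group of the union is generated by the gain groups of D1 and D2. The cap destroys
  submodularity, but only if \<open>l = k + 1\<close> and only by one. In that situation either the splits of D1 and D2
  agree on X and combine to a split of the union, which is then capped as well, or X falls apart into
  pieces that meet in at most two vertices and are, wholly or in part, balanced. In the latter case the
  bounds for the pieces show that I has at most \<open>f X - 1\<close> edges in X, which compensates the loss
  (\<open>capped_alpha_Un_le_of_tight\<close>). The assumption on subgroups of order two is needed when D1 and D2 are
  split at the same vertex: if the gain between its two copies is an involution, interchanging the
  copies on one piece of X leads to a different split of X, and the two splits need not combine.

  All statements about gains are reduced to potentials, that is to functions q on vertices such that
  \<open>q (tail G e) \<otimes> \<psi> e \<otimes> inv (q (head G e))\<close> lies in a given subgroup. A set is balanced if and only if it has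
  a potential for the trivial subgroup, it is balanced in some split at v if and only if it has one with
  two admissible values at v, and the gain group at v is the least subgroup for which a connected set
  has a potential with value one at v.
\<close>

section \<open>Connected edge sets\<close>

lemma edge_verts_empty [simp]: "edge_verts G {} = {}"
  by (simp add: edge_verts_def)

lemma edge_verts_Un [simp]: "edge_verts G (F \<union> F') = edge_verts G F \<union> edge_verts G F'"
  by (auto simp: edge_verts_def)

lemma edge_verts_insert [simp]:
  "edge_verts G (insert e F) = {tail G e, head G e} \<union> edge_verts G F"
  by (auto simp: edge_verts_def)

lemma edge_verts_mono: "F \<subseteq> F' \<Longrightarrow> edge_verts G F \<subseteq> edge_verts G F'"
  by (auto simp: edge_verts_def)

lemma tail_in_edge_verts [intro]: "e \<in> F \<Longrightarrow> tail G e \<in> edge_verts G F"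
  and head_in_edge_verts [intro]: "e \<in> F \<Longrightarrow> head G e \<in> edge_verts G F"
  by (auto simp: edge_verts_def)

lemma edge_verts_finite: "finite F \<Longrightarrow> finite (edge_verts G F)"
  by (simp add: edge_verts_def)

lemma edge_verts_nonempty: "F \<noteq> {} \<Longrightarrow> edge_verts G F \<noteq> {}"
  by (auto simp: edge_verts_def)

text \<open>
  Connectivity in terms of cuts: a claim about all vertices of a connected set then only needs a
  vertex set that no edge leaves, instead of an induction on walks.
\<close>

lemma conn_sets_iff_cut:
  "F \<in> conn_sets G \<longleftrightarrow> F \<subseteq> arcs G \<and> F \<noteq> {} \<and>
     (\<forall>S. edge_verts G F \<inter> S \<noteq> {} \<and> (\<forall>e\<in>F. tail G e \<in> S \<longleftrightarrow> head G e \<in> S) \<longrightarrow>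
        edge_verts G F \<subseteq> S)"
    (is "_ \<longleftrightarrow> _ \<and> _ \<and> ?cut")
proof -
  let ?V = "edge_verts G F"
  let ?A = "\<Union>e\<in>F. {(tail G e, head G e), (head G e, tail G e)}"
  let ?R = "rtrancl_on ?V ?A"
  have *: "Digraph_Component.connected (edge_subgraph G F) \<longleftrightarrow>
      ?V \<noteq> {} \<and> (\<forall>u\<in>?V. \<forall>v\<in>?V. (u, v) \<in> ?R)"
    by (simp add: connected_def strongly_connected_def reachable_def mk_symmetric_def
        edge_subgraph_def arcs_ends_def arc_to_ends_def with_proj_def)
  have "(\<forall>u\<in>?V. \<forall>v\<in>?V. (u, v) \<in> ?R) \<longleftrightarrow> ?cut"
  proof
    assume R: "\<forall>u\<in>?V. \<forall>v\<in>?V. (u, v) \<in> ?R"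
    show ?cut
    proof (intro allI impI subsetI)
      fix S v
      assume S: "?V \<inter> S \<noteq> {} \<and> (\<forall>e\<in>F. tail G e \<in> S \<longleftrightarrow> head G e \<in> S)" and v: "v \<in> ?V"
      then obtain u where u: "u \<in> ?V" "u \<in> S" by auto
      with R v have "(u, v) \<in> ?R" by auto
      then show "v \<in> S"
        by (induction rule: rtrancl_on_induct) (use u S in auto)
    qed
  next
    assume cut: ?cut
    show "\<forall>u\<in>?V. \<forall>v\<in>?V. (u, v) \<in> ?R"
    proof (intro ballI)
      fix u v assume u: "u \<in> ?V" and v: "v \<in> ?V"
      let ?S = "{x. (u, x) \<in> ?R}"
      have "?V \<inter> ?S \<noteq> {}" using u by auto
      moreover have "\<forall>e\<in>F. tail G e \<in> ?S \<longleftrightarrow> head G e \<in> ?S"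
        by (auto intro: rtrancl_on_into_rtrancl_on)
      ultimately have "?V \<subseteq> ?S" using cut[rule_format, of ?S] by blast
      then show "(u, v) \<in> ?R" using v by auto
    qed
  qed
  with * edge_verts_nonempty[of F G] show ?thesis
    unfolding conn_sets_def by (cases "F = {}") simp_all
qed

lemma conn_setsD:
  assumes "F \<in> conn_sets G"
  shows "F \<subseteq> arcs G" "F \<noteq> {}"
  using assms by (auto simp: conn_sets_def)

lemma conn_sets_cut_closed:
  assumes "F \<in> conn_sets G" and "v \<in> edge_verts G F" "v \<in> S"
    and "\<And>e. e \<in> F \<Longrightarrow> tail G e \<in> S \<longleftrightarrow> head G e \<in> S"
  shows "edge_verts G F \<subseteq> S"
proof -
  have "edge_verts G F \<inter> S \<noteq> {} \<and> (\<forall>e\<in>F. tail G e \<in> S \<longleftrightarrow> head G e \<in> S)"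
    using assms(2-4) by blast
  then show ?thesis using assms(1) by (simp add: conn_sets_iff_cut)
qed

lemma conn_sets_single: "e \<in> arcs G \<Longrightarrow> {e} \<in> conn_sets G"
  by (auto simp: conn_sets_iff_cut)

lemma conn_sets_Un:
  assumes "F \<in> conn_sets G" "F' \<in> conn_sets G" "edge_verts G F \<inter> edge_verts G F' \<noteq> {}"
  shows "F \<union> F' \<in> conn_sets G"
proof -
  from assms(3) obtain w where w: "w \<in> edge_verts G F" "w \<in> edge_verts G F'" by auto
  { fix S
    assume S: "edge_verts G (F \<union> F') \<inter> S \<noteq> {}"
      "\<forall>e\<in>F \<union> F'. tail G e \<in> S \<longleftrightarrow> head G e \<in> S"
    have F: "edge_verts G F \<subseteq> S" if "u \<in> edge_verts G F" "u \<in> S" for u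
      using conn_sets_cut_closed[OF assms(1) that] S(2) by blast
    have F': "edge_verts G F' \<subseteq> S" if "u \<in> edge_verts G F'" "u \<in> S" for u
      using conn_sets_cut_closed[OF assms(2) that] S(2) by blast
    from S(1) obtain u where "u \<in> edge_verts G F \<or> u \<in> edge_verts G F'" "u \<in> S" by auto
    then have "w \<in> S" using w F[of u] F'[of u] by blast
    then have "edge_verts G (F \<union> F') \<subseteq> S"
      using F[OF w(1)] F'[OF w(2)] by simp }
  note cut = this
  have "F \<union> F' \<subseteq> arcs G" "F \<union> F' \<noteq> {}"
    using conn_setsD[OF assms(1)] conn_setsD[OF assms(2)] by auto
  then show ?thesis unfolding conn_sets_iff_cut by (intro conjI allI impI cut) auto
qed

text \<open>
  An inclusion-maximal connected subset shares no vertex with the remaining edges, since a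
  remaining edge at a common vertex could be added to it.
\<close>

lemma conn_component_exists:
  assumes "finite X" "X \<subseteq> arcs G" "X \<noteq> {}"
  obtains Z where "Z \<in> conn_sets G" "Z \<subseteq> X" "edge_verts G Z \<inter> edge_verts G (X - Z) = {}"
proof -
  let ?M = "{Z. Z \<in> conn_sets G \<and> Z \<subseteq> X}"
  from assms(3) obtain e where "e \<in> X" by auto
  then have "?M \<noteq> {}" using assms conn_sets_single[of e G] by auto
  moreover have "finite ?M" using assms(1) by (rule_tac finite_subset[of _ "Pow X"]) auto
  ultimately obtain Z where Z: "Z \<in> ?M" and max: "\<forall>Y\<in>?M. Z \<subseteq> Y \<longrightarrow> Z = Y"
    using finite_has_maximal[of ?M] by blast
  have "edge_verts G Z \<inter> edge_verts G (X - Z) = {}"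
  proof (rule ccontr)
    assume "edge_verts G Z \<inter> edge_verts G (X - Z) \<noteq> {}"
    then obtain x where x: "x \<in> edge_verts G Z" "x \<in> edge_verts G (X - Z)" by auto
    then obtain f where f: "f \<in> X - Z" "x = tail G f \<or> x = head G f"
      by (auto simp: edge_verts_def)
    then have "Z \<union> {f} \<in> conn_sets G"
      using Z assms f x by (intro conn_sets_Un conn_sets_single) auto
    then have "Z = Z \<union> {f}" using max f Z by blast
    then show False using f by blast
  qed
  with Z show ?thesis by (intro that[of Z]) simp_all
qed

section \<open>Walks and gains\<close>

text \<open>
  Only the group is fixed here, so that the results apply both to a graph and to its splits.
\<close>

locale label_group = group \<Gamma> for \<Gamma> :: "('g, 'm) monoid_scheme" (structure)
begin

text \<open>
  Switching with q replaces the label of e by \<open>q (tail G e) \<otimes> \<psi> e \<otimes> inv (q (head G e))\<close>; the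
  switched labels are required to lie in the subgroup H. For trivial H this certifies balance.
\<close>

definition potential :: "('a, 'b) pre_digraph \<Rightarrow> ('b \<Rightarrow> 'g) \<Rightarrow> 'g set \<Rightarrow> 'b set \<Rightarrow> ('a \<Rightarrow> 'g) \<Rightarrow> bool"
  where "potential G \<psi> H F q \<longleftrightarrow> (\<forall>x. q x \<in> carrier \<Gamma>) \<and>
    (\<forall>e\<in>F. q (tail G e) \<otimes> \<psi> e \<otimes> inv (q (head G e)) \<in> H)"

end

lemma bidir_simps:
  "verts (bidir (edge_subgraph G F)) = edge_verts G F"
  "arcs (bidir (edge_subgraph G F)) = F \<times> UNIV"
  "tail (bidir (edge_subgraph G F)) (e, b) = (if b then tail G e else head G e)"
  "head (bidir (edge_subgraph G F)) (e, b) = (if b then head G e else tail G e)"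
  by (simp_all add: bidir_def edge_subgraph_def)

lemma walk_in_iff:
  "walk_in G F u p v \<longleftrightarrow> u \<in> edge_verts G F \<and> fst ` set p \<subseteq> F \<and>
     pre_digraph.cas (bidir (edge_subgraph G F)) u p v"
proof -
  have *: "set p \<subseteq> F \<times> UNIV \<longleftrightarrow> fst ` set p \<subseteq> F" by auto
  show ?thesis
    unfolding walk_in_def pre_digraph.awalk_def bidir_simps * ..
qed

lemma wf_bidir: "wf_digraph (bidir (edge_subgraph G F))"
  by unfold_locales (auto simp: bidir_simps)

lemma walk_in_Nil: "walk_in G F u [] v \<longleftrightarrow> u = v \<and> u \<in> edge_verts G F"
  by (auto simp: walk_in_iff pre_digraph.cas.simps(1))

lemma walk_in_Cons:
  "walk_in G F u ((e, b) # p) v \<longleftrightarrow> e \<in> F \<and>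
     u = (if b then tail G e else head G e) \<and>
     walk_in G F (if b then head G e else tail G e) p v"
  unfolding walk_in_iff pre_digraph.cas.simps(2) bidir_simps by auto

lemma walk_in_verts:
  assumes "walk_in G F u p v"
  shows "u \<in> edge_verts G F" "v \<in> edge_verts G F"
proof -
  interpret wf_digraph "bidir (edge_subgraph G F)" by (rule wf_bidir)
  show "u \<in> edge_verts G F" "v \<in> edge_verts G F"
    using assms awalk_hd_in_verts[of u p v] awalk_last_in_verts[of u p v]
    by (auto simp: walk_in_def bidir_simps)
qed

lemma walk_in_append:
  "walk_in G F u p v \<Longrightarrow> walk_in G F v q w \<Longrightarrow> walk_in G F u (p @ q) w"
  by (induction p arbitrary: u) (auto simp: walk_in_Nil walk_in_Cons split_paired_all)

definition rev_walk :: "('b \<times> bool) list \<Rightarrow> ('b \<times> bool) list" where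
  "rev_walk p = rev (map (\<lambda>(e, b). (e, \<not> b)) p)"

lemma walk_in_rev: "walk_in G F u p v \<Longrightarrow> walk_in G F v (rev_walk p) u"
proof (induction p arbitrary: u)
  case Nil
  then show ?case by (auto simp: rev_walk_def walk_in_Nil)
next
  case (Cons a p)
  obtain e b where a: "a = (e, b)" by (cases a)
  let ?y = "if b then head G e else tail G e"
  have 1: "e \<in> F" "u = (if b then tail G e else head G e)" "walk_in G F ?y p v"
    using Cons.prems by (auto simp: a walk_in_Cons)
  have "walk_in G F ?y [(e, \<not> b)] u"
    using 1 by (auto simp: walk_in_Cons walk_in_Nil)
  then show ?case
    using walk_in_append[OF Cons.IH[OF 1(3)]] by (simp add: rev_walk_def a)
qed

context label_group
begin

lemma cancel_simps:
  assumes "x \<in> carrier \<Gamma>" "y \<in> carrier \<Gamma>"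
  shows "x \<otimes> (inv x \<otimes> y) = y" "inv x \<otimes> (x \<otimes> y) = y"
  using assms by (simp_all flip: m_assoc)

lemma gain_Nil [simp]: "gain \<Gamma> \<psi> [] = \<one>"
  by (simp add: gain_def)

lemma gain_Cons [simp]:
  "gain \<Gamma> \<psi> ((e, b) # p) = (if b then \<psi> e else inv (\<psi> e)) \<otimes> gain \<Gamma> \<psi> p"
  by (simp add: gain_def)

lemma gain_closed:
  assumes "\<And>e. e \<in> F \<Longrightarrow> \<psi> e \<in> carrier \<Gamma>" "fst ` set p \<subseteq> F"
  shows "gain \<Gamma> \<psi> p \<in> carrier \<Gamma>"
  using assms(2) by (induction p) (auto simp: assms(1))

lemma gain_append:
  assumes "\<And>e. e \<in> F \<Longrightarrow> \<psi> e \<in> carrier \<Gamma>" "fst ` set p \<subseteq> F" "fst ` set q \<subseteq> F"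
  shows "gain \<Gamma> \<psi> (p @ q) = gain \<Gamma> \<psi> p \<otimes> gain \<Gamma> \<psi> q"
  using assms(2)
proof (induction p)
  case Nil
  then show ?case using gain_closed[of F \<psi>, OF assms(1,3)] by simp
next
  case (Cons a p)
  then show ?case
    using gain_closed[of F \<psi>, OF assms(1,3)] gain_closed[of F \<psi> p, OF assms(1)] assms(1)
    by (cases a) (auto simp: m_assoc)
qed

lemma gain_rev:
  assumes "\<And>e. e \<in> F \<Longrightarrow> \<psi> e \<in> carrier \<Gamma>" "fst ` set p \<subseteq> F"
  shows "gain \<Gamma> \<psi> (rev_walk p) = inv (gain \<Gamma> \<psi> p)"
  using assms(2)
proof (induction p)
  case Nil
  then show ?case by (simp add: rev_walk_def)
next
  case (Cons a p)
  obtain e b where a: "a = (e, b)" by (cases a)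
  have e: "\<psi> e \<in> carrier \<Gamma>" using Cons.prems assms(1) a by auto
  have p: "gain \<Gamma> \<psi> p \<in> carrier \<Gamma>" using gain_closed[of F \<psi> p, OF assms(1)] Cons.prems by auto
  have s: "fst ` set (rev_walk p) \<subseteq> F" using Cons.prems by (force simp: rev_walk_def)
  have "gain \<Gamma> \<psi> (rev_walk (a # p)) = gain \<Gamma> \<psi> (rev_walk p @ [(e, \<not> b)])"
    by (simp add: rev_walk_def a)
  also have "\<dots> = gain \<Gamma> \<psi> (rev_walk p) \<otimes> gain \<Gamma> \<psi> [(e, \<not> b)]"
    using Cons.prems a s by (intro gain_append[of F \<psi>] assms(1)) auto
  also have "\<dots> = inv (gain \<Gamma> \<psi> p) \<otimes> (if b then inv (\<psi> e) else \<psi> e)"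
    using Cons e by (auto simp: a)
  also have "\<dots> = inv (gain \<Gamma> \<psi> (a # p))"
    using e p by (simp add: a inv_mult_group)
  finally show ?case .
qed

lemma walk_edges: "walk_in G F u p v \<Longrightarrow> fst ` set p \<subseteq> F"
  by (simp add: walk_in_iff)

text \<open>
  The gain of a walk with respect to the switched labels telescopes.
\<close>

lemma potential_walk:
  assumes H: "subgroup H \<Gamma>" and \<psi>: "\<And>e. e \<in> F \<Longrightarrow> \<psi> e \<in> carrier \<Gamma>"
    and q: "potential G \<psi> H F q" and p: "walk_in G F u p v"
  shows "q u \<otimes> gain \<Gamma> \<psi> p \<otimes> inv (q v) \<in> H"
  using p
proof (induction p arbitrary: u)
  case Nil
  then show ?case using q H by (auto simp: walk_in_Nil potential_def subgroup.one_closed)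
next
  case (Cons a p)
  obtain e b where a: "a = (e, b)" by (cases a)
  let ?y = "if b then head G e else tail G e"
  let ?h = "if b then \<psi> e else inv (\<psi> e)"
  have 1: "e \<in> F" "u = (if b then tail G e else head G e)" "walk_in G F ?y p v"
    using Cons.prems by (auto simp: a walk_in_Cons)
  have c: "\<psi> e \<in> carrier \<Gamma>" "\<And>x. q x \<in> carrier \<Gamma>" "gain \<Gamma> \<psi> p \<in> carrier \<Gamma>"
    using 1(1) \<psi> q gain_closed[of F \<psi> p, OF \<psi> walk_edges[OF 1(3)]] by (auto simp: potential_def)
  have e: "q (tail G e) \<otimes> \<psi> e \<otimes> inv (q (head G e)) \<in> H"
    using q 1(1) by (simp add: potential_def)
  have "q u \<otimes> ?h \<otimes> inv (q ?y) \<in> H"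
  proof (cases b)
    case True
    then show ?thesis using e 1(2) by simp
  next
    case False
    have "inv (q (tail G e) \<otimes> \<psi> e \<otimes> inv (q (head G e))) \<in> H"
      using e H by (rule subgroup.m_inv_closed[rotated])
    then show ?thesis using False 1(2) c by (simp add: inv_mult_group m_assoc)
  qed
  from subgroup.m_closed[OF H this Cons.IH[OF 1(3)]]
  have "q u \<otimes> ?h \<otimes> inv (q ?y) \<otimes> (q ?y \<otimes> gain \<Gamma> \<psi> p \<otimes> inv (q v)) \<in> H" .
  also have "q u \<otimes> ?h \<otimes> inv (q ?y) \<otimes> (q ?y \<otimes> gain \<Gamma> \<psi> p \<otimes> inv (q v))
    = q u \<otimes> ?h \<otimes> (inv (q ?y) \<otimes> q ?y) \<otimes> (gain \<Gamma> \<psi> p \<otimes> inv (q v))"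
    using c by (simp add: m_assoc cancel_simps)
  also have "\<dots> = q u \<otimes> gain \<Gamma> \<psi> (a # p) \<otimes> inv (q v)"
    using c by (simp add: a m_assoc)
  finally show ?case .
qed

text \<open>
  The value at x is the gain of a chosen walk from the representative \<open>r x\<close> to x. The switched label
  of an edge is then the gain of the closed walk that runs to its tail, along the edge, and back from
  its head. Choosing the empty walk at the representatives normalises the potential there.
\<close>

lemma walk_potential_exists:
  assumes \<psi>: "\<And>e. e \<in> F \<Longrightarrow> \<psi> e \<in> carrier \<Gamma>"
    and r: "\<And>x. x \<in> edge_verts G F \<Longrightarrow> \<exists>p. walk_in G F (r x) p x"
    and re: "\<And>e. e \<in> F \<Longrightarrow> r (tail G e) = r (head G e)"
  obtains q where "\<And>x. q x \<in> carrier \<Gamma>" "\<And>x. x \<in> edge_verts G F \<Longrightarrow> r x = x \<Longrightarrow> q x = \<one>"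
    "\<And>e. e \<in> F \<Longrightarrow> \<exists>p. walk_in G F (r (tail G e)) p (r (tail G e)) \<and>
      gain \<Gamma> \<psi> p = q (tail G e) \<otimes> \<psi> e \<otimes> inv (q (head G e))"
proof -
  have "\<exists>p. x \<in> edge_verts G F \<longrightarrow> walk_in G F (r x) p x \<and> (r x = x \<longrightarrow> p = [])" for x
    using r[of x] by (cases "r x = x") (auto simp: walk_in_Nil)
  then obtain w where w: "\<And>x. x \<in> edge_verts G F \<Longrightarrow> walk_in G F (r x) (w x) x"
    "\<And>x. x \<in> edge_verts G F \<Longrightarrow> r x = x \<Longrightarrow> w x = []" by metis
  define q where "q x = (if x \<in> edge_verts G F then gain \<Gamma> \<psi> (w x) else \<one>)" for x
  have qc: "q x \<in> carrier \<Gamma>" for x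
    using gain_closed[of F \<psi> "w x", OF \<psi> walk_edges[OF w(1)]] by (simp add: q_def)
  show ?thesis
  proof (rule that)
    fix e assume e: "e \<in> F"
    then have t: "tail G e \<in> edge_verts G F" and h: "head G e \<in> edge_verts G F" by auto
    let ?p = "w (tail G e) @ (e, True) # rev_walk (w (head G e))"
    note wt = w(1)[OF t] and wh = walk_in_rev[OF w(1)[OF h]]
    have "walk_in G F (r (tail G e)) ?p (r (tail G e))"
      by (intro walk_in_append[OF wt]) (use e wh re in \<open>auto simp: walk_in_Cons\<close>)
    moreover have "gain \<Gamma> \<psi> ?p = q (tail G e) \<otimes> \<psi> e \<otimes> inv (q (head G e))"
      using gain_append[of F \<psi>, OF \<psi> walk_edges[OF wt], of "(e, True) # rev_walk (w (head G e))"]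
        walk_edges[OF wh] e gain_rev[of F \<psi>, OF \<psi> walk_edges[OF w(1)[OF h]]] t h qc \<psi>
      by (simp add: q_def[of "tail G e"] q_def[of "head G e"] m_assoc)
        (metis q_def qc inv_closed m_assoc)
    ultimately show "\<exists>p. walk_in G F (r (tail G e)) p (r (tail G e)) \<and>
      gain \<Gamma> \<psi> p = q (tail G e) \<otimes> \<psi> e \<otimes> inv (q (head G e))" by blast
  qed (use qc w in \<open>auto simp: q_def\<close>)
qed

lemma conn_walk_exists:
  assumes F: "F \<in> conn_sets G" and "v \<in> edge_verts G F" "x \<in> edge_verts G F"
  obtains p where "walk_in G F v p x"
proof -
  let ?S = "{x. \<exists>p. walk_in G F v p x}"
  have arc: "walk_in G F (tail G e) [(e, True)] (head G e)"
      "walk_in G F (head G e) [(e, False)] (tail G e)" if "e \<in> F" for e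
    using that by (auto simp: walk_in_Cons walk_in_Nil)
  have "v \<in> ?S" using assms(2) walk_in_Nil[of G F v v] by blast
  then have "edge_verts G F \<subseteq> ?S"
    using arc walk_in_append[of G F] by (intro conn_sets_cut_closed[OF F assms(2)]) blast+
  with assms(3) that show ?thesis by auto
qed

section \<open>Balanced sets and potentials\<close>

text \<open>
  A closed walk that repeats an edge but no vertex can only go along that edge and straight back.
\<close>

lemma closed_walk_gain_distinct_heads:
  assumes \<psi>: "\<And>e. e \<in> F \<Longrightarrow> \<psi> e \<in> carrier \<Gamma>"
    and p: "walk_in G F u p u"
    and d: "distinct (map (head (bidir (edge_subgraph G F))) p)"
    and nd: "\<not> distinct (map fst p)"
  shows "gain \<Gamma> \<psi> p = \<one>"
proof -
  let ?hd = "head (bidir (edge_subgraph G F))"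
  have split: "\<exists>w. walk_in G F u xs w \<and> walk_in G F w ys v"
    if "walk_in G F u (xs @ ys) v" for u v xs ys
    using that
    by (induction xs arbitrary: u)
      (auto simp: walk_in_Cons walk_in_Nil split_paired_all dest: walk_in_verts)
  have last_hd: "?hd (last xs) = w" if "walk_in G F u xs w" "xs \<noteq> []" for u xs w
    using that
    by (induction xs arbitrary: u)
      (auto simp: walk_in_Cons walk_in_Nil split_paired_all bidir_simps split: if_splits)
  from nd obtain ws i zs ys where "map fst p = ws @ [i] @ ys @ [i] @ zs"
    using not_distinct_decomp by blast
  then obtain xs b ys b' zs where p_eq: "p = xs @ (i, b) # ys @ (i, b') # zs"
    by (auto simp: map_eq_append_conv map_eq_Cons_conv append_eq_map_conv Cons_eq_map_conv)
  \<comment> \<open>Two traversals in the same direction would have the same head.\<close>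
  have b': "b' = (\<not> b)" using d by (cases b; cases b') (auto simp: p_eq)
  from split[OF p[unfolded p_eq]] obtain w where
    w: "walk_in G F u xs w" "walk_in G F w ((i, b) # ys @ (i, b') # zs) u" by blast
  from w(2) have i: "i \<in> F" and w_eq: "w = ?hd (i, b')"
    and rest: "walk_in G F (?hd (i, b)) (ys @ (i, b') # zs) u"
    by (auto simp: walk_in_Cons bidir_simps b')
  from split[OF rest] obtain y where
    y: "walk_in G F (?hd (i, b)) ys y" "walk_in G F y ((i, b') # zs) u" by blast
  from y(2) have y_eq: "y = ?hd (i, b)" and z: "walk_in G F (?hd (i, b')) zs u"
    by (auto simp: walk_in_Cons bidir_simps b')
  \<comment> \<open>The two traversals run in opposite directions, so each of the three remaining pieces ends in
    a head of one of them; a nonempty piece would repeat that head.\<close>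
  have fresh: "?hd (i, b') \<notin> ?hd ` set xs" "?hd (i, b) \<notin> ?hd ` set ys"
    "?hd (i, b') \<notin> ?hd ` set zs"
    using d unfolding p_eq by auto
  have "xs = []"
    using last_hd[OF w(1)] w_eq fresh(1) last_in_set[of xs] by (metis imageI)
  moreover have "ys = []"
    using last_hd[OF y(1)] y_eq fresh(2) last_in_set[of ys] by (metis imageI)
  moreover have "zs = []"
    using last_hd[OF z] w(1) w_eq \<open>xs = []\<close> fresh(3) last_in_set[of zs]
    by (metis imageI walk_in_Nil)
  ultimately show ?thesis using \<psi>[OF i] by (simp add: p_eq b')
qed

text \<open>
  A closed walk that repeats a vertex decomposes into two shorter closed walks; one that does not is
  a cycle or goes back and forth along one edge.
\<close>

lemma balanced_closed_walk:
  assumes \<psi>: "\<And>e. e \<in> F \<Longrightarrow> \<psi> e \<in> carrier \<Gamma>"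
    and bal: "balanced \<Gamma> G \<psi> F" and "walk_in G F u p u"
  shows "gain \<Gamma> \<psi> p = \<one>"
  using assms(3)
proof (induction "length p" arbitrary: u p rule: less_induct)
  case less
  interpret W: wf_digraph "bidir (edge_subgraph G F)" by (rule wf_bidir)
  show ?case
  proof (cases p)
    case (Cons a p')
    obtain e b where a: "a = (e, b)" by (cases a)
    let ?y = "if b then head G e else tail G e"
    have p': "walk_in G F ?y p' u" and e: "e \<in> F"
      using less.prems by (auto simp: Cons a walk_in_Cons)
    let ?vs = "pre_digraph.awalk_verts (bidir (edge_subgraph G F))"
    have verts: "tl (?vs u p) = ?vs ?y p'"
      by (simp add: Cons a W.awalk_verts.simps bidir_simps)
    show ?thesis
    proof (cases "distinct (?vs ?y p')")
      case True
      have heads: "map (head (bidir (edge_subgraph G F))) p = ?vs ?y p'"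
        using W.awalk_verts_conv'[of u p u] less.prems verts
        by (simp add: walk_in_iff Cons a split_def)
      show ?thesis
      proof (cases "distinct (map fst p)")
        case True2: True
        have "cycle_in G F p"
          using True True2 less.prems verts Cons
          by (auto simp: cycle_in_def W.cycle_def walk_in_def)
        then show ?thesis using bal by (auto simp: balanced_def)
      next
        case False
        then show ?thesis
          using closed_walk_gain_distinct_heads[of F \<psi>, OF \<psi> less.prems] heads True by simp
      qed
    next
      case False
      from W.awalk_not_distinct_decomp[OF p'[unfolded walk_in_def] this]
      obtain q r s w where d: "p' = q @ r @ s" "r \<noteq> []"
        "walk_in G F ?y q w" "walk_in G F w r w" "walk_in G F w s u"
        by (auto simp: walk_in_def)
      have "gain \<Gamma> \<psi> r = \<one>"
        using d by (intro less.hyps[OF _ d(4)]) (auto simp: Cons)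
      moreover have "walk_in G F u ((a # q) @ s) u"
        by (rule walk_in_append[OF _ d(5)]) (use less.prems d(3) in \<open>auto simp: Cons a walk_in_Cons\<close>)
      then have "gain \<Gamma> \<psi> ((a # q) @ s) = \<one>"
        by (intro less.hyps) (use d in \<open>auto simp: Cons\<close>)
      moreover have "p = (a # q) @ r @ s" by (simp add: Cons d)
      moreover note sets = walk_edges[OF d(3)] walk_edges[OF d(4)] walk_edges[OF d(5)]
      have "gain \<Gamma> \<psi> ((a # q) @ r @ s) = gain \<Gamma> \<psi> (a # q) \<otimes> (gain \<Gamma> \<psi> r \<otimes> gain \<Gamma> \<psi> s)"
        "gain \<Gamma> \<psi> ((a # q) @ s) = gain \<Gamma> \<psi> (a # q) \<otimes> gain \<Gamma> \<psi> s"
        using sets e gain_append[of F \<psi> "a # q" "r @ s", OF \<psi>] gain_append[of F \<psi> r s, OF \<psi>]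
          gain_append[of F \<psi> "a # q" s, OF \<psi>] by (auto simp: a image_Un)
      moreover have "gain \<Gamma> \<psi> s \<in> carrier \<Gamma>" using gain_closed[of F \<psi>, OF \<psi> sets(3)] .
      ultimately show ?thesis by simp
    qed
  qed simp
qed

text \<open>
  The set F need not be connected: splitting a vertex may disconnect it. Each component has its own
  representative, at which the walks defining the potential start.
\<close>

lemma balanced_iff_potential:
  assumes \<psi>: "\<And>e. e \<in> F \<Longrightarrow> \<psi> e \<in> carrier \<Gamma>"
  shows "balanced \<Gamma> G \<psi> F \<longleftrightarrow> (\<exists>q. potential G \<psi> {\<one>} F q)"
proof
  assume bal: "balanced \<Gamma> G \<psi> F"
  \<comment> \<open>The predicate under the choice is the same for all vertices of a component, and so is r.\<close>
  define r where "r x = (SOME y. \<exists>p. walk_in G F y p x)" for x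
  have r: "\<exists>p. walk_in G F (r x) p x" if "x \<in> edge_verts G F" for x
    unfolding r_def by (rule someI[of _ x]) (use that in \<open>auto simp: walk_in_Nil intro: exI[of _ "[]"]\<close>)
  have re: "r (tail G e) = r (head G e)" if "e \<in> F" for e
  proof -
    have arc: "walk_in G F (tail G e) [(e, True)] (head G e)"
      "walk_in G F (head G e) [(e, False)] (tail G e)"
      using that by (auto simp: walk_in_Cons walk_in_Nil)
    then have "(\<exists>p. walk_in G F y p (tail G e)) = (\<exists>p. walk_in G F y p (head G e))" for y
      using walk_in_append[of G F] by blast
    then show ?thesis by (simp add: r_def)
  qed
  obtain q where q: "\<And>x. q x \<in> carrier \<Gamma>"
    "\<And>e. e \<in> F \<Longrightarrow> \<exists>p. walk_in G F (r (tail G e)) p (r (tail G e)) \<and>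
      gain \<Gamma> \<psi> p = q (tail G e) \<otimes> \<psi> e \<otimes> inv (q (head G e))"
    using walk_potential_exists[of F \<psi> G r, OF \<psi> r re] by metis
  then have "potential G \<psi> {\<one>} F q"
    using balanced_closed_walk[of F \<psi>, OF \<psi> bal] by (fastforce simp: potential_def)
  then show "\<exists>q. potential G \<psi> {\<one>} F q" by blast
next
  assume "\<exists>q. potential G \<psi> {\<one>} F q"
  then obtain q where q: "potential G \<psi> {\<one>} F q" ..
  have "gain \<Gamma> \<psi> p = \<one>" if p: "cycle_in G F p" for p
  proof -
    from p obtain u where u: "walk_in G F u p u"
      by (auto simp: cycle_in_def pre_digraph.cycle_def walk_in_def)
    have "q u \<otimes> gain \<Gamma> \<psi> p \<otimes> inv (q u) = \<one>"
      using potential_walk[OF triv_subgroup \<psi> q u] by simp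
    moreover have c: "q u \<in> carrier \<Gamma>" "gain \<Gamma> \<psi> p \<in> carrier \<Gamma>"
      using q gain_closed[of F \<psi>, OF \<psi> walk_edges[OF u]] by (auto simp: potential_def)
    ultimately have "q u \<otimes> gain \<Gamma> \<psi> p = q u"
      by (metis inv_closed inv_equality inv_inv m_closed)
    then show ?thesis using c by (metis l_cancel_one)
  qed
  then show "balanced \<Gamma> G \<psi> F" by (auto simp: balanced_def)
qed

end

section \<open>Potentials of splits\<close>

text \<open>
  The values that a potential of a split at v offers to an edge end at x: the two copies of v carry
  the values \<open>p v\<close> and \<open>g\<close>.
\<close>

definition vertex_values :: "('a \<Rightarrow> 'g) \<Rightarrow> 'a \<Rightarrow> 'g \<Rightarrow> 'a \<Rightarrow> 'g set" where
  "vertex_values p v g x = (if x = v then {p v, g} else {p x})"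

locale gain_graph = labeled_graph \<Gamma> G \<psi>
  for \<Gamma> :: "('g, 'm) monoid_scheme" (structure)
    and G :: "('a, 'b) pre_digraph" and \<psi> :: "'b \<Rightarrow> 'g"

sublocale gain_graph \<subseteq> label_group \<Gamma> ..

context gain_graph
begin

abbreviation bal :: "'b set \<Rightarrow> bool" where "bal F \<equiv> balanced \<Gamma> G \<psi> F"

abbreviation V :: "'b set \<Rightarrow> 'a set" where "V F \<equiv> edge_verts G F"

text \<open>
  A potential of some split at v, expressed in the graph itself: every edge end at v may choose
  between the values of the two copies.
\<close>

definition split_potential :: "'b set \<Rightarrow> 'a \<Rightarrow> ('a \<Rightarrow> 'g) \<Rightarrow> 'g \<Rightarrow> bool" where
  "split_potential F v p g \<longleftrightarrow> (\<forall>x. p x \<in> carrier \<Gamma>) \<and> g \<in> carrier \<Gamma> \<and>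
     (\<forall>e\<in>F. \<exists>a\<in>vertex_values p v g (tail G e). \<exists>b\<in>vertex_values p v g (head G e).
        a \<otimes> \<psi> e = b)"

lemma eq_one_iff:
  assumes "x \<in> carrier \<Gamma>" "y \<in> carrier \<Gamma>"
  shows "x \<otimes> inv y = \<one> \<longleftrightarrow> x = y"
  using assms by (metis inv_closed inv_inv inv_unique' r_inv inv_equality)

lemma split_potentialD:
  assumes "split_potential F v p g"
  shows "p x \<in> carrier \<Gamma>" "g \<in> carrier \<Gamma>"
    "e \<in> F \<Longrightarrow> \<exists>a\<in>vertex_values p v g (tail G e). \<exists>b\<in>vertex_values p v g (head G e). a \<otimes> \<psi> e = b"
  using assms by (auto simp: split_potential_def)

lemma split_potential_mono:
  "split_potential D v p g \<Longrightarrow> F \<subseteq> D \<Longrightarrow> split_potential F v p g"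
  unfolding split_potential_def by blast

lemma balanced_iff:
  assumes "F \<subseteq> arcs G"
  shows "bal F \<longleftrightarrow> (\<exists>q. (\<forall>x. q x \<in> carrier \<Gamma>) \<and> (\<forall>e\<in>F. q (tail G e) \<otimes> \<psi> e = q (head G e)))"
proof -
  have \<psi>: "\<psi> e \<in> carrier \<Gamma>" if "e \<in> F" for e using that assms label_closed by auto
  have "potential G \<psi> {\<one>} F q \<longleftrightarrow>
      (\<forall>x. q x \<in> carrier \<Gamma>) \<and> (\<forall>e\<in>F. q (tail G e) \<otimes> \<psi> e = q (head G e))" for q
    using \<psi> by (auto simp: potential_def eq_one_iff)
  then show ?thesis using balanced_iff_potential[of F \<psi> G, OF \<psi>] by simp
qed

lemma balanced_mono: "bal D \<Longrightarrow> F \<subseteq> D \<Longrightarrow> D \<subseteq> arcs G \<Longrightarrow> bal F"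
  using balanced_iff[of D] balanced_iff[of F] by blast

text \<open>
  Every vertex incident to F then offers just one value, so \<open>p\<close> is an ordinary potential.
\<close>

lemma balanced_split_potential:
  assumes "F \<subseteq> arcs G" and "split_potential F v p g" and "v \<notin> V F \<or> g = p v"
  shows "bal F"
proof -
  have "p (tail G e) \<otimes> \<psi> e = p (head G e)" if e: "e \<in> F" for e
  proof -
    have "vertex_values p v g (tail G e) = {p (tail G e)}"
      "vertex_values p v g (head G e) = {p (head G e)}"
      using assms(3) e tail_in_edge_verts[OF e, of G] head_in_edge_verts[OF e, of G]
      by (auto simp: vertex_values_def)
    then show ?thesis using split_potentialD(3)[OF assms(2) e] by simp
  qed
  then show ?thesis
    using assms(1,2) by (auto simp: balanced_iff split_potential_def)
qed

text \<open>
  The split can be recovered from the two values at v: an edge belongs to the first copy if its end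
  at v fits \<open>p v\<close>, and an unbalanced loop is reversed unless it leads from \<open>p v\<close> to \<open>g\<close>.
\<close>

lemma split_balanced_iff:
  assumes F: "F \<subseteq> arcs G" and v: "v \<in> verts G"
  shows "(\<exists>E1 R. E1 \<subseteq> nonloops_at G v \<and> R \<subseteq> unbalanced_loops_at \<Gamma> G \<psi> v \<and>
        balanced \<Gamma> (split_graph \<Gamma> G \<psi> v E1) (split_label \<Gamma> \<psi> R) F) \<longleftrightarrow>
    (\<exists>p g. split_potential F v p g)" (is "?L \<longleftrightarrow> ?R")
proof -
  have lab: "split_label \<Gamma> \<psi> R e \<in> carrier \<Gamma>" if "e \<in> F" for R e
    using that F label_closed by (auto simp: split_label_def)
  have \<psi>: "\<psi> e \<in> carrier \<Gamma>" if "e \<in> F" for e using that F label_closed by auto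
  have bal_iff: "balanced \<Gamma> (split_graph \<Gamma> G \<psi> v E1) (split_label \<Gamma> \<psi> R) F \<longleftrightarrow>
      (\<exists>q. (\<forall>x. q x \<in> carrier \<Gamma>) \<and> (\<forall>e\<in>F. q (tail (split_graph \<Gamma> G \<psi> v E1) e) \<otimes>
         split_label \<Gamma> \<psi> R e = q (head (split_graph \<Gamma> G \<psi> v E1) e)))" for E1 R
  proof -
    let ?t = "tail (split_graph \<Gamma> G \<psi> v E1)" and ?h = "head (split_graph \<Gamma> G \<psi> v E1)"
    let ?l = "split_label \<Gamma> \<psi> R"
    have "potential (split_graph \<Gamma> G \<psi> v E1) ?l {\<one>} F q \<longleftrightarrow>
      (\<forall>x. q x \<in> carrier \<Gamma>) \<and> (\<forall>e\<in>F. q (?t e) \<otimes> ?l e = q (?h e))" for q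
      using lab by (auto simp: potential_def eq_one_iff)
    then show ?thesis
      using balanced_iff_potential[of F ?l "split_graph \<Gamma> G \<psi> v E1", OF lab] by simp
  qed
  show ?thesis
  proof
    assume ?L
    then obtain E1 R q where R: "R \<subseteq> unbalanced_loops_at \<Gamma> G \<psi> v"
      and qc: "\<And>x. q x \<in> carrier \<Gamma>"
      and q: "\<And>e. e \<in> F \<Longrightarrow> q (tail (split_graph \<Gamma> G \<psi> v E1) e) \<otimes>
         split_label \<Gamma> \<psi> R e = q (head (split_graph \<Gamma> G \<psi> v E1) e)"
      unfolding bal_iff by blast
    define p where "p x = (if x = v then q Split1 else q (Old x))" for x
    have "\<exists>a\<in>vertex_values p v (q Split2) (tail G e). \<exists>b\<in>vertex_values p v (q Split2) (head G e).
        a \<otimes> \<psi> e = b" if e: "e \<in> F" for e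
    proof (cases "e \<in> loops_at G v")
      case True
      then have th: "tail G e = v" "head G e = v" by (auto simp: loops_at_def)
      show ?thesis
      proof (cases "e \<in> unbalanced_loops_at \<Gamma> G \<psi> v")
        case True2: True
        have "q Split1 \<otimes> split_label \<Gamma> \<psi> R e = q Split2"
          using q[OF e] True True2 by (simp add: split_graph_def)
        then have "q Split1 \<otimes> \<psi> e = q Split2 \<or> q Split2 \<otimes> \<psi> e = q Split1"
          using qc \<psi>[OF e] by (auto simp: split_label_def inv_solve_right' split: if_splits)
        then show ?thesis by (auto simp: th vertex_values_def p_def)
      next
        case False
        then have "\<psi> e = \<one>" using True by (auto simp: unbalanced_loops_at_def)
        then show ?thesis using qc by (auto simp: th vertex_values_def p_def)
      qed
    next
      case False
      then have "e \<notin> unbalanced_loops_at \<Gamma> G \<psi> v" by (auto simp: unbalanced_loops_at_def)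
      moreover from this have "e \<notin> R" using R by auto
      ultimately have "q (split_end v E1 e (tail G e)) \<otimes> \<psi> e = q (split_end v E1 e (head G e))"
        using q[OF e] False by (simp add: split_graph_def split_label_def)
      moreover have "q (split_end v E1 e x) \<in> vertex_values p v (q Split2) x" for x
        by (auto simp: split_end_def vertex_values_def p_def)
      ultimately show ?thesis by metis
    qed
    then have "split_potential F v p (q Split2)"
      using qc by (auto simp: split_potential_def p_def)
    then show ?R by blast
  next
    assume ?R
    then obtain p g where pg: "split_potential F v p g" by blast
    define E1 where "E1 = {e \<in> nonloops_at G v. tail G e = v \<and> p v \<otimes> \<psi> e = p (head G e) \<or>
      head G e = v \<and> p (tail G e) \<otimes> \<psi> e = p v}"
    define R where "R = {e \<in> unbalanced_loops_at \<Gamma> G \<psi> v. p v \<otimes> \<psi> e \<noteq> g}"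
    define q where "q x = (case x of Old y \<Rightarrow> p y | Split1 \<Rightarrow> p v | Split2 \<Rightarrow> g)" for x
    note pgc = split_potentialD(1,2)[OF pg]
    have qc: "q x \<in> carrier \<Gamma>" for x using pgc by (auto simp: q_def split: split_vertex.split)
    have "q (tail (split_graph \<Gamma> G \<psi> v E1) e) \<otimes>
         split_label \<Gamma> \<psi> R e = q (head (split_graph \<Gamma> G \<psi> v E1) e)" if e: "e \<in> F" for e
    proof -
      from split_potentialD(3)[OF pg e] obtain a b where
        a: "a \<in> vertex_values p v g (tail G e)" and b: "b \<in> vertex_values p v g (head G e)"
        and ab: "a \<otimes> \<psi> e = b" by blast
      show ?thesis
      proof (cases "e \<in> loops_at G v")
        case True
        then have th: "tail G e = v" "head G e = v" by (auto simp: loops_at_def)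
        show ?thesis
        proof (cases "e \<in> unbalanced_loops_at \<Gamma> G \<psi> v")
          case True2: True
          then have ne: "\<psi> e \<noteq> \<one>" by (auto simp: unbalanced_loops_at_def)
          have "a \<noteq> b"
          proof
            assume "a = b"
            then have "\<psi> e = \<one>"
              using ab a pgc \<psi>[OF e] by (auto simp: vertex_values_def th)
            with ne show False ..
          qed
          then have "p v \<otimes> \<psi> e = g \<or> g \<otimes> \<psi> e = p v"
            using a b ab by (auto simp: vertex_values_def th)
          then have "p v \<otimes> split_label \<Gamma> \<psi> R e = g"
            using pgc \<psi>[OF e] True2 by (auto simp: R_def split_label_def inv_solve_right')
          then show ?thesis using True True2 by (simp add: split_graph_def q_def)
        next
          case False
          then have "\<psi> e = \<one>" using True by (auto simp: unbalanced_loops_at_def)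
          moreover have "e \<notin> R" using False by (simp add: R_def)
          ultimately show ?thesis using True False pgc
            by (simp add: split_graph_def q_def split_label_def)
        qed
      next
        case False
        then have ne: "\<not> (tail G e = v \<and> head G e = v)" using e F by (auto simp: loops_at_def)
        have nu: "e \<notin> unbalanced_loops_at \<Gamma> G \<psi> v" "e \<notin> R"
          using False by (auto simp: unbalanced_loops_at_def R_def)
        have "q (split_end v E1 e (tail G e)) \<otimes> \<psi> e = q (split_end v E1 e (head G e))"
          using a b ab ne e F
          by (auto simp: split_end_def q_def vertex_values_def E1_def nonloops_at_def)
        then show ?thesis using False nu by (simp add: split_graph_def split_label_def)
      qed
    qed
    then have "balanced \<Gamma> (split_graph \<Gamma> G \<psi> v E1) (split_label \<Gamma> \<psi> R) F"
      unfolding bal_iff using qc by blast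
    moreover have "E1 \<subseteq> nonloops_at G v" "R \<subseteq> unbalanced_loops_at \<Gamma> G \<psi> v"
      by (auto simp: E1_def R_def)
    ultimately show ?L by blast
  qed
qed

text \<open>
  The split vertex may range over all values of the vertex type, because only a split at a vertex of
  F can make an unbalanced set balanced.
\<close>

lemma near_balanced_iff:
  assumes "F \<in> conn_sets G"
  shows "near_balanced \<Gamma> G \<psi> F \<longleftrightarrow> \<not> bal F \<and> (\<exists>v p g. split_potential F v p g)"
proof -
  note F = conn_setsD(1)[OF assms]
  have "v \<in> verts G" if "split_potential F v p g" "\<not> bal F" for v p g
  proof -
    have "v \<in> V F" using balanced_split_potential[OF F that(1)] that(2) by blast
    then show ?thesis using F wellformed by (auto simp: edge_verts_def)
  qed
  then show ?thesis
    unfolding near_balanced_def using assms split_balanced_iff[OF F] by blast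
qed

lemma split_potential_translate:
  assumes "F \<subseteq> arcs G" "split_potential F v p g" "c \<in> carrier \<Gamma>"
  shows "split_potential F v (\<lambda>x. c \<otimes> p x) (c \<otimes> g)"
proof -
  have *: "vertex_values (\<lambda>x. c \<otimes> p x) v (c \<otimes> g) x = (\<lambda>a. c \<otimes> a) ` vertex_values p v g x" for x
    by (auto simp: vertex_values_def)
  note pgc = split_potentialD(1,2)[OF assms(2)]
  have "\<exists>a\<in>vertex_values (\<lambda>x. c \<otimes> p x) v (c \<otimes> g) (tail G e).
      \<exists>b\<in>vertex_values (\<lambda>x. c \<otimes> p x) v (c \<otimes> g) (head G e). a \<otimes> \<psi> e = b" if e: "e \<in> F" for e
  proof -
    from split_potentialD(3)[OF assms(2) e] obtain a b where
      a: "a \<in> vertex_values p v g (tail G e)" and b: "b \<in> vertex_values p v g (head G e)"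
      and ab: "a \<otimes> \<psi> e = b" by blast
    have "a \<in> carrier \<Gamma>" using a pgc by (auto simp: vertex_values_def split: if_splits)
    moreover have "\<psi> e \<in> carrier \<Gamma>" using e assms(1) label_closed by auto
    ultimately have "c \<otimes> a \<otimes> \<psi> e = c \<otimes> b" using assms(3) ab by (simp add: m_assoc)
    then show ?thesis unfolding * using a b by blast
  qed
  then show ?thesis using pgc assms(3) by (simp add: split_potential_def)
qed

section \<open>Gain groups\<close>

abbreviation gg :: "'b set \<Rightarrow> 'a \<Rightarrow> 'g set" where
  "gg F v \<equiv> gain_group \<Gamma> G \<psi> F v"

lemma gain_group_subgroup:
  assumes "F \<subseteq> arcs G"
  shows "subgroup (gg F v) \<Gamma>"
proof -
  have "gain \<Gamma> \<psi> p \<in> carrier \<Gamma>" if "walk_in G F v p v" for p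
    by (rule gain_closed[of F \<psi>, OF label_closed walk_edges[OF that]]) (use assms in auto)
  then show ?thesis unfolding gain_group_def by (intro generate_is_subgroup) blast
qed

text \<open>
  Together with \<open>gain_group_potential\<close> this describes the gain group at v without walks: it is the
  least subgroup modulo which there is a potential with value one at v.
\<close>

lemma gain_group_least:
  assumes "F \<subseteq> arcs G" "subgroup H \<Gamma>" "potential G \<psi> H F q" "q v = \<one>"
  shows "gg F v \<subseteq> H"
  unfolding gain_group_def
proof (rule generate_subgroup_incl[OF _ assms(2)], clarify)
  fix p assume p: "walk_in G F v p v"
  have \<psi>: "\<psi> e \<in> carrier \<Gamma>" if "e \<in> F" for e using that assms label_closed by auto
  have "gain \<Gamma> \<psi> p \<in> carrier \<Gamma>" by (rule gain_closed[of F \<psi>, OF \<psi> walk_edges[OF p]])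
  then show "gain \<Gamma> \<psi> p \<in> H" using potential_walk[OF assms(2) \<psi> assms(3) p] assms(4) by simp
qed

lemma gain_group_potential:
  assumes F: "F \<in> conn_sets G" and v: "v \<in> V F"
  obtains q where "q v = \<one>" "potential G \<psi> (gg F v) F q"
proof -
  have \<psi>: "\<psi> e \<in> carrier \<Gamma>" if "e \<in> F" for e using that conn_setsD(1)[OF F] label_closed by auto
  have r: "\<exists>p. walk_in G F v p x" if "x \<in> V F" for x using conn_walk_exists[OF F v that] by blast
  obtain q where q: "\<And>x. q x \<in> carrier \<Gamma>" "\<And>x. x \<in> V F \<Longrightarrow> v = x \<Longrightarrow> q x = \<one>"
    "\<And>e. e \<in> F \<Longrightarrow> \<exists>p. walk_in G F v p v \<and>
      gain \<Gamma> \<psi> p = q (tail G e) \<otimes> \<psi> e \<otimes> inv (q (head G e))"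
    using walk_potential_exists[of F \<psi> G "\<lambda>_. v", OF \<psi> r refl] by blast
  have "q (tail G e) \<otimes> \<psi> e \<otimes> inv (q (head G e)) \<in> gg F v" if "e \<in> F" for e
    using q(3)[OF that] unfolding gain_group_def by (metis (mono_tags, lifting) generate.incl mem_Collect_eq)
  then have "potential G \<psi> (gg F v) F q" using q(1) by (simp add: potential_def)
  with q(2)[OF v refl] show ?thesis by (rule that)
qed

lemma subgroup_mult_left_iff:
  assumes "subgroup H \<Gamma>" "a \<in> H" "x \<in> carrier \<Gamma>"
  shows "a \<otimes> x \<in> H \<longleftrightarrow> x \<in> H"
proof
  have a: "a \<in> carrier \<Gamma>" by (rule subgroup.mem_carrier[OF assms(1,2)])
  assume "a \<otimes> x \<in> H"
  then have "inv a \<otimes> (a \<otimes> x) \<in> H"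
    by (rule subgroup.m_closed[OF assms(1) subgroup.m_inv_closed[OF assms(1,2)]])
  then show "x \<in> H" using a assms by (simp add: cancel_simps)
qed (use assms subgroup.m_closed[OF assms(1)] in blast)

lemma subgroup_mult_right_iff:
  assumes "subgroup H \<Gamma>" "a \<in> H" "x \<in> carrier \<Gamma>"
  shows "x \<otimes> a \<in> H \<longleftrightarrow> x \<in> H"
proof
  have a: "a \<in> carrier \<Gamma>" by (rule subgroup.mem_carrier[OF assms(1,2)])
  assume "x \<otimes> a \<in> H"
  then have "(x \<otimes> a) \<otimes> inv a \<in> H"
    by (rule subgroup.m_closed[OF assms(1) _ subgroup.m_inv_closed[OF assms(1,2)]])
  then show "x \<in> H" using a assms by (simp add: m_assoc)
qed (use assms subgroup.m_closed[OF assms(1)] in blast)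

text \<open>
  No edge joins a vertex where the two potentials agree modulo H to one where they do not.
\<close>

lemma potential_unique:
  assumes F: "F \<in> conn_sets G" and H: "subgroup H \<Gamma>"
    and q: "potential G \<psi> H F q" and q': "potential G \<psi> H F q'"
    and v: "v \<in> V F" "q v = q' v" and x: "x \<in> V F"
  shows "q x \<otimes> inv (q' x) \<in> H"
proof -
  have c: "q x \<in> carrier \<Gamma>" "q' x \<in> carrier \<Gamma>" for x using q q' by (auto simp: potential_def)
  have "V F \<subseteq> {x. q x \<otimes> inv (q' x) \<in> H}"
  proof (rule conn_sets_cut_closed[OF F v(1)])
    show "v \<in> {x. q x \<otimes> inv (q' x) \<in> H}"
      using v c subgroup.one_closed[OF H] by simp
  next
    fix e assume e: "e \<in> F"
    let ?t = "tail G e" and ?h = "head G e"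
    have \<psi>: "\<psi> e \<in> carrier \<Gamma>" using e conn_setsD(1)[OF F] label_closed by auto
    let ?A = "q ?t \<otimes> \<psi> e \<otimes> inv (q ?h)" and ?B = "q' ?t \<otimes> \<psi> e \<otimes> inv (q' ?h)"
    have A: "?A \<in> H" and B: "?B \<in> H" using e q q' by (auto simp: potential_def)
    have eq: "q ?t \<otimes> inv (q' ?t) = ?A \<otimes> (q ?h \<otimes> inv (q' ?h)) \<otimes> inv ?B"
      using c \<psi> by (simp add: m_assoc inv_mult_group cancel_simps)
    show "?t \<in> {x. q x \<otimes> inv (q' x) \<in> H} \<longleftrightarrow> ?h \<in> {x. q x \<otimes> inv (q' x) \<in> H}"
      unfolding mem_Collect_eq eq
      using A subgroup.m_inv_closed[OF H B] c \<psi>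
      by (simp only: subgroup_mult_left_iff[OF H] subgroup_mult_right_iff[OF H] m_closed inv_closed)
  qed
  with x show ?thesis by auto
qed

text \<open>
  The set contains a walk between the two copies of v, and its gain is g. Otherwise multiplying the
  split potential by \<open>inv g\<close> on the part not joined to the first copy would give both copies the value
  one, and the set would be balanced. That part is recognised as the set of vertices where the split
  potential differs from a potential modulo the gain group.
\<close>

lemma split_gain_mem_gain_group:
  assumes F: "F \<in> conn_sets G" and unbal: "\<not> bal F"
    and pg: "split_potential F v p g" and p1: "p v = \<one>" and v: "v \<in> V F"
  shows "g \<in> gg F v"
proof (rule ccontr)
  let ?H = "gg F v"
  assume g: "g \<notin> ?H"
  note FG = conn_setsD(1)[OF F]
  note H = gain_group_subgroup[OF FG, of v]
  obtain q where qv: "q v = \<one>" and q: "potential G \<psi> ?H F q"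
    using gain_group_potential[OF F v] by blast
  note pgc = split_potentialD(1,2)[OF pg]
  have qc: "q x \<in> carrier \<Gamma>" for x using q by (simp add: potential_def)
  define p' where "p' x = (if x = v then \<one> else if q x \<otimes> inv (p x) \<in> ?H then p x else inv g \<otimes> p x)" for x
  \<comment> \<open>At v this covers both copies: \<open>inv g\<close> is not in the gain group, so the value g is shifted to one.\<close>
  have p': "p' x = (if q x \<otimes> inv a \<in> ?H then a else inv g \<otimes> a)" and ac: "a \<in> carrier \<Gamma>"
    if a: "a \<in> vertex_values p v g x" for a x
  proof -
    show ac: "a \<in> carrier \<Gamma>" using a pgc by (auto simp: vertex_values_def split: if_splits)
    show "p' x = (if q x \<otimes> inv a \<in> ?H then a else inv g \<otimes> a)"
    proof (cases "x = v")
      case True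
      have "inv g \<notin> ?H" using g subgroup.m_inv_closed[OF H] pgc(2) by (metis inv_inv)
      then show ?thesis using a True p1 qv pgc subgroup.one_closed[OF H]
        by (auto simp: vertex_values_def p'_def)
    next
      case False
      then show ?thesis using a by (simp add: vertex_values_def p'_def)
    qed
  qed
  have "p' (tail G e) \<otimes> \<psi> e = p' (head G e)" if e: "e \<in> F" for e
  proof -
    let ?t = "tail G e" and ?h = "head G e"
    from split_potentialD(3)[OF pg e] obtain a b where
      a: "a \<in> vertex_values p v g ?t" and b: "b \<in> vertex_values p v g ?h"
      and ab: "a \<otimes> \<psi> e = b" by blast
    note c = ac[OF a] ac[OF b] pgc(2) qc
    have \<psi>: "\<psi> e \<in> carrier \<Gamma>" using e FG label_closed by auto
    let ?A = "q ?t \<otimes> \<psi> e \<otimes> inv (q ?h)"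
    have A: "?A \<in> ?H" using q e by (auto simp: potential_def)
    have "q ?t \<otimes> inv a = ?A \<otimes> (q ?h \<otimes> inv b)"
      using c \<psi> unfolding ab[symmetric] by (simp add: m_assoc inv_mult_group cancel_simps)
    then have "q ?t \<otimes> inv a \<in> ?H \<longleftrightarrow> q ?h \<otimes> inv b \<in> ?H"
      using subgroup_mult_left_iff[OF H A] c by simp
    then show ?thesis
      unfolding p'[OF a] p'[OF b] using ab c \<psi> by (auto simp: m_assoc)
  qed
  moreover have "p' x \<in> carrier \<Gamma>" for x using pgc by (auto simp: p'_def)
  ultimately have "bal F" using balanced_iff[OF FG] by blast
  with unbal show False ..
qed

end

section \<open>The polymatroid value of an edge set\<close>

locale count_data = gain_graph \<Gamma> G \<psi>
  for \<Gamma> :: "('g, 'm) monoid_scheme" (structure)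
    and G :: "('a, 'b) pre_digraph" and \<psi> :: "'b \<Rightarrow> 'g" +
  fixes \<alpha> :: "'g set \<Rightarrow> int" and k l :: int
  assumes k_ge_1: "k \<ge> 1" and l_nonneg: "0 \<le> l" and l_le: "l \<le> k + 1"
    and alpha_range: "\<And>X. X \<subseteq> carrier \<Gamma> \<Longrightarrow> \<alpha> X \<in> {0..l}"
    and alpha_polymatroidal: "polymatroidal \<Gamma> \<alpha>"
    and alpha_normalized: "normalized \<Gamma> \<alpha>"
    and alpha_Z2: "\<And>H. subgroup H \<Gamma> \<Longrightarrow> \<Gamma>\<lparr>carrier := H\<rparr> \<cong> integer_mod_group 2 \<Longrightarrow> \<alpha> H \<le> k"
begin

lemma
  shows alpha_submod:
    "X \<subseteq> carrier \<Gamma> \<Longrightarrow> Y \<subseteq> carrier \<Gamma> \<Longrightarrow> \<alpha> (X \<union> Y) + \<alpha> (X \<inter> Y) \<le> \<alpha> X + \<alpha> Y"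
  and alpha_mono: "X \<subseteq> Y \<Longrightarrow> Y \<subseteq> carrier \<Gamma> \<Longrightarrow> \<alpha> X \<le> \<alpha> Y"
  and alpha_conj: "X \<subseteq> carrier \<Gamma> \<Longrightarrow> c \<in> carrier \<Gamma> \<Longrightarrow> \<alpha> ((c <# X) #> inv c) = \<alpha> X"
  and alpha_generate: "X \<subseteq> carrier \<Gamma> \<Longrightarrow> \<alpha> (generate \<Gamma> X) = \<alpha> X"
proof -
  note P = alpha_polymatroidal[unfolded polymatroidal_def, THEN conjunct2]
  show "\<alpha> (X \<union> Y) + \<alpha> (X \<inter> Y) \<le> \<alpha> X + \<alpha> Y" if "X \<subseteq> carrier \<Gamma>" "Y \<subseteq> carrier \<Gamma>"
    using P[THEN conjunct1, rule_format, of X Y] that by simp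
  show "\<alpha> X \<le> \<alpha> Y" if "X \<subseteq> Y" "Y \<subseteq> carrier \<Gamma>"
    using P[THEN conjunct2, THEN conjunct1, rule_format, of X Y] that by simp
  show "\<alpha> ((c <# X) #> inv c) = \<alpha> X" if "X \<subseteq> carrier \<Gamma>" "c \<in> carrier \<Gamma>"
    using P[THEN conjunct2, THEN conjunct2, THEN conjunct1, rule_format, of X c] that by simp
  show "\<alpha> (generate \<Gamma> X) = \<alpha> X" if "X \<subseteq> carrier \<Gamma>"
    using P[THEN conjunct2, THEN conjunct2, THEN conjunct2, rule_format, of X] that by simp
qed

lemma alpha_one: "\<alpha> {\<one>} = 0"
  using alpha_normalized by (simp add: normalized_def)

lemma alpha_pos: "g \<in> carrier \<Gamma> \<Longrightarrow> g \<noteq> \<one> \<Longrightarrow> \<alpha> {g} \<ge> 1"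
  using alpha_normalized alpha_range[of "{g}"] unfolding normalized_def by force

text \<open>
  This is where the bound on subgroups of order two enters.
\<close>

lemma alpha_involution_le:
  assumes g: "g \<in> carrier \<Gamma>" and ne: "g \<noteq> \<one>" and gg: "g \<otimes> g = \<one>"
  shows "\<alpha> {g} \<le> k"
proof -
  have inv: "inv g = g" using g gg by (simp add: inv_equality)
  have sub: "subgroup {\<one>, g} \<Gamma>"
    by (rule subgroupI) (use g gg inv in auto)
  let ?h = "\<lambda>x. if x = g then 1 else (0::int)"
  have "?h \<in> iso (\<Gamma>\<lparr>carrier := {\<one>, g}\<rparr>) (integer_mod_group 2)"
    using g gg ne
    by (auto simp: iso_iff hom_def carrier_integer_mod_group inj_on_def image_iff
        split: if_splits)
  then have "\<alpha> {\<one>, g} \<le> k" by (intro alpha_Z2[OF sub] is_isoI)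
  moreover have "\<alpha> {g} \<le> \<alpha> {\<one>, g}" using g by (intro alpha_mono) auto
  ultimately show ?thesis by simp
qed

abbreviation gain_alpha :: "'b set \<Rightarrow> int" where "gain_alpha F \<equiv> alpha_tilde \<Gamma> G \<psi> \<alpha> F"
abbreviation near_bal :: "'b set \<Rightarrow> bool" where "near_bal F \<equiv> near_balanced \<Gamma> G \<psi> F"
abbreviation f :: "'b set \<Rightarrow> int" where "f F \<equiv> f_alpha \<Gamma> G \<psi> \<alpha> k l F"

text \<open>
  The last summand of f.
\<close>

definition capped_alpha :: "'b set \<Rightarrow> int" where "capped_alpha F = (if near_bal F then min (gain_alpha F) k else gain_alpha F)"

lemma f_eq: "f F = k * int (card (V F)) - l + capped_alpha F"
  by (simp add: f_alpha_def capped_alpha_def)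

text \<open>
  Normalising the potential at v replaces H by a conjugate subgroup, on which \<open>\<alpha>\<close> has the same value.
\<close>

lemma alpha_gain_group_le:
  assumes "F \<subseteq> arcs G" "subgroup H \<Gamma>" "potential G \<psi> H F q"
  shows "\<alpha> (gg F v) \<le> \<alpha> H"
proof -
  have qc: "q x \<in> carrier \<Gamma>" for x using assms(3) by (simp add: potential_def)
  have Hc: "H \<subseteq> carrier \<Gamma>" using assms(2) by (rule subgroup.subset)
  let ?c = "inv (q v)"
  let ?K = "(?c <# H) #> inv ?c"
  have K: "subgroup ?K \<Gamma>" using assms(2) qc by (intro subgroup_conjugation_is_surj2) auto
  have pot: "potential G \<psi> ?K F (\<lambda>x. ?c \<otimes> q x)"
    unfolding potential_def
  proof (intro conjI allI ballI)
    fix e assume e: "e \<in> F"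
    then have \<psi>: "\<psi> e \<in> carrier \<Gamma>" using assms(1) label_closed by auto
    have h: "q (tail G e) \<otimes> \<psi> e \<otimes> inv (q (head G e)) \<in> H"
      using assms(3) e by (simp add: potential_def)
    have "?c \<otimes> q (tail G e) \<otimes> \<psi> e \<otimes> inv (?c \<otimes> q (head G e)) =
      ?c \<otimes> (q (tail G e) \<otimes> \<psi> e \<otimes> inv (q (head G e))) \<otimes> inv ?c"
      using qc \<psi> by (simp add: m_assoc inv_mult_group)
    then show "?c \<otimes> q (tail G e) \<otimes> \<psi> e \<otimes> inv (?c \<otimes> q (head G e)) \<in> ?K"
      using h by (auto simp: l_coset_def r_coset_def)
  qed (use qc in simp)
  have "gg F v \<subseteq> ?K"
    by (rule gain_group_least[OF assms(1) K pot]) (use qc in simp)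
  then have "\<alpha> (gg F v) \<le> \<alpha> ?K" using subgroup.subset[OF K] by (rule alpha_mono)
  also have "\<dots> = \<alpha> H" using alpha_conj[OF Hc, of ?c] qc by simp
  finally show ?thesis .
qed

lemma gain_alpha_le:
  assumes "F \<subseteq> arcs G" "subgroup H \<Gamma>" "potential G \<psi> H F q"
  shows "gain_alpha F \<le> \<alpha> H"
  using alpha_gain_group_le[OF assms] by (simp add: alpha_tilde_def)

lemma gain_alpha_eq:
  assumes F: "F \<in> conn_sets G" and v: "v \<in> V F"
  shows "gain_alpha F = \<alpha> (gg F v)"
proof -
  note FG = conn_setsD(1)[OF F]
  have le: "\<alpha> (gg F u) \<le> \<alpha> (gg F w)" if w: "w \<in> V F" for u w
  proof -
    obtain q where "potential G \<psi> (gg F w) F q" using gain_group_potential[OF F w] by blast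
    then show ?thesis by (rule alpha_gain_group_le[OF FG gain_group_subgroup[OF FG]])
  qed
  have "(SOME v. v \<in> V F) \<in> V F" using v by (rule someI)
  then show ?thesis using le[OF v] le unfolding alpha_tilde_def by (meson order_antisym)
qed

lemma gain_alpha_range:
  assumes "F \<subseteq> arcs G"
  shows "0 \<le> gain_alpha F" "gain_alpha F \<le> l"
  using alpha_range[OF subgroup.subset[OF gain_group_subgroup[OF assms]]]
  by (auto simp: alpha_tilde_def)

lemma potential_mono: "potential G \<psi> H D q \<Longrightarrow> F \<subseteq> D \<Longrightarrow> potential G \<psi> H F q"
  by (auto simp: potential_def)

lemma gain_alpha_mono:
  assumes "F \<subseteq> D" "D \<in> conn_sets G"
  shows "gain_alpha F \<le> gain_alpha D"
proof -
  note D = conn_setsD[OF assms(2)]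
  obtain v where v: "v \<in> V D" using edge_verts_nonempty[OF D(2), of G] by blast
  obtain q where "potential G \<psi> (gg D v) D q" using gain_group_potential[OF assms(2) v] by blast
  then show ?thesis
    using gain_alpha_le[OF _ gain_group_subgroup[OF D(1)] potential_mono[OF _ assms(1)]]
      gain_alpha_eq[OF assms(2) v] D(1) assms(1) by auto
qed

lemma gain_alpha_balanced:
  assumes "F \<subseteq> arcs G" "bal F"
  shows "gain_alpha F = 0"
proof -
  have \<psi>: "\<psi> e \<in> carrier \<Gamma>" if "e \<in> F" for e using that assms(1) label_closed by auto
  obtain q where "potential G \<psi> {\<one>} F q"
    using balanced_iff_potential[of F \<psi> G, OF \<psi>] assms(2) by blast
  then show ?thesis
    using gain_alpha_le[OF assms(1) triv_subgroup] alpha_one gain_alpha_range[OF assms(1)] by fastforce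
qed

lemma gain_alpha_unbalanced:
  assumes F: "F \<in> conn_sets G" and "\<not> bal F"
  shows "1 \<le> gain_alpha F"
proof -
  note FG = conn_setsD[OF F]
  have \<psi>: "\<psi> e \<in> carrier \<Gamma>" if "e \<in> F" for e using that FG(1) label_closed by auto
  obtain v where v: "v \<in> V F" using edge_verts_nonempty[OF FG(2), of G] by blast
  obtain q where q: "potential G \<psi> (gg F v) F q" using gain_group_potential[OF F v] by blast
  note sub = gain_group_subgroup[OF FG(1), of v]
  have "gg F v \<noteq> {\<one>}" using q assms(2) balanced_iff_potential[of F \<psi> G, OF \<psi>] by auto
  then obtain g where g: "g \<in> gg F v" "g \<noteq> \<one>" using subgroup.one_closed[OF sub] by blast
  have "1 \<le> \<alpha> {g}" using g subgroup.subset[OF sub] by (intro alpha_pos) auto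
  also have "\<dots> \<le> \<alpha> (gg F v)" using g subgroup.subset[OF sub] by (intro alpha_mono) auto
  finally show ?thesis using gain_alpha_eq[OF F v] by simp
qed

text \<open>
  With \<open>gain_alpha_split_ge\<close>, this gives all connected unbalanced subsets of a near-balanced set the
  same value, that of the gain between the two copies of the split vertex.
\<close>

lemma gain_alpha_split_le:
  assumes F: "F \<in> conn_sets G" and pg: "split_potential F v p g" and p1: "p v = \<one>"
  shows "gain_alpha F \<le> \<alpha> {g}"
proof -
  note FG = conn_setsD(1)[OF F]
  note pgc = split_potentialD(1,2)[OF pg]
  let ?H = "generate \<Gamma> {g}"
  have sub: "subgroup ?H \<Gamma>" using pgc by (intro generate_is_subgroup) auto
  have "p (tail G e) \<otimes> \<psi> e \<otimes> inv (p (head G e)) \<in> ?H" if e: "e \<in> F" for e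
  proof -
    from split_potentialD(3)[OF pg e] obtain a b where
      a: "a \<in> vertex_values p v g (tail G e)" and b: "b \<in> vertex_values p v g (head G e)"
      and ab: "a \<otimes> \<psi> e = b" by blast
    have c: "a \<in> carrier \<Gamma>" "b \<in> carrier \<Gamma>" "\<psi> e \<in> carrier \<Gamma>"
      using a b pgc e FG label_closed by (auto simp: vertex_values_def split: if_splits)
    have gH: "g \<in> ?H" "inv g \<in> ?H" "\<one> \<in> ?H"
      by (auto intro: generate.incl generate.inv generate.one)
    have "p (tail G e) \<otimes> inv a \<in> ?H"
      using a gH pgc p1 by (auto simp: vertex_values_def split: if_splits)
    moreover have "b \<otimes> inv (p (head G e)) \<in> ?H"
      using b gH pgc p1 by (auto simp: vertex_values_def split: if_splits)
    ultimately have "(p (tail G e) \<otimes> inv a) \<otimes> (b \<otimes> inv (p (head G e))) \<in> ?H"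
      by (rule generate.eng)
    also have "(p (tail G e) \<otimes> inv a) \<otimes> (b \<otimes> inv (p (head G e))) =
        p (tail G e) \<otimes> \<psi> e \<otimes> inv (p (head G e))"
      unfolding ab[symmetric] using c pgc by (simp add: m_assoc cancel_simps)
    finally show ?thesis .
  qed
  then have "potential G \<psi> ?H F p" using pgc by (simp add: potential_def)
  from gain_alpha_le[OF FG sub this] show ?thesis using alpha_generate[of "{g}"] pgc by simp
qed

lemma gain_alpha_split_ge:
  assumes F: "F \<in> conn_sets G" and "\<not> bal F"
    and pg: "split_potential F v p g" and p1: "p v = \<one>"
  shows "\<alpha> {g} \<le> gain_alpha F"
proof -
  note FG = conn_setsD(1)[OF F]
  have v: "v \<in> V F" using balanced_split_potential[OF FG pg] assms(2) by blast
  have "g \<in> gg F v" using split_gain_mem_gain_group[OF F assms(2) pg p1 v] .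
  then have "\<alpha> {g} \<le> \<alpha> (gg F v)"
    using subgroup.subset[OF gain_group_subgroup[OF FG, of v]] by (intro alpha_mono) auto
  then show ?thesis using gain_alpha_eq[OF F v] by simp
qed

text \<open>
  The gain group of the union is generated by those of the two sets: as the intersection is connected
  and contains all common vertices, potentials of the two sets that agree at one common vertex agree
  at all of them, modulo the generated group, and can be glued.
\<close>

lemma gain_alpha_submodular:
  assumes D1: "D1 \<in> conn_sets G" and D2: "D2 \<in> conn_sets G" and C: "D1 \<inter> D2 \<in> conn_sets G"
    and VC: "V (D1 \<inter> D2) = V D1 \<inter> V D2"
  shows "gain_alpha (D1 \<union> D2) + gain_alpha (D1 \<inter> D2) \<le> gain_alpha D1 + gain_alpha D2"
proof -
  let ?C = "D1 \<inter> D2"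
  note G1 = conn_setsD(1)[OF D1] and G2 = conn_setsD(1)[OF D2]
  obtain v where v: "v \<in> V ?C" using edge_verts_nonempty[OF conn_setsD(2)[OF C], of G] by blast
  then have v1: "v \<in> V D1" and v2: "v \<in> V D2" using VC by auto
  let ?H1 = "gg D1 v" and ?H2 = "gg D2 v"
  note S1 = gain_group_subgroup[OF G1, of v] and S2 = gain_group_subgroup[OF G2, of v]
  note c1 = subgroup.subset[OF S1] and c2 = subgroup.subset[OF S2]
  let ?H = "generate \<Gamma> (?H1 \<union> ?H2)"
  have S: "subgroup ?H \<Gamma>" using c1 c2 by (intro generate_is_subgroup) auto
  have H1: "?H1 \<subseteq> ?H" and H2: "?H2 \<subseteq> ?H" by (auto intro: generate.incl)
  obtain q1 where q1: "q1 v = \<one>" "potential G \<psi> ?H1 D1 q1"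
    using gain_group_potential[OF D1 v1] by blast
  obtain q2 where q2: "q2 v = \<one>" "potential G \<psi> ?H2 D2 q2"
    using gain_group_potential[OF D2 v2] by blast
  have q1c: "q1 x \<in> carrier \<Gamma>" and q2c: "q2 x \<in> carrier \<Gamma>" for x
    using q1 q2 by (auto simp: potential_def)
  have q1H: "potential G \<psi> ?H ?C q1" and q2H: "potential G \<psi> ?H ?C q2"
    using q1(2) q2(2) H1 H2 unfolding potential_def by blast+
  have agree: "q1 x \<otimes> inv (q2 x) \<in> ?H" if "x \<in> V D1 \<inter> V D2" for x
    using potential_unique[OF C S q1H q2H v] q1(1) q2(1) that VC by auto
  define q where "q x = (if x \<in> V D1 then q1 x else q2 x)" for x
  have qq2: "q x \<otimes> inv (q2 x) \<in> ?H" if "x \<in> V D2" for x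
    using that agree q2c generate.one by (auto simp: q_def)
  have "q (tail G e) \<otimes> \<psi> e \<otimes> inv (q (head G e)) \<in> ?H" if e: "e \<in> D1 \<union> D2" for e
  proof (cases "e \<in> D1")
    case True
    then show ?thesis using q1(2) H1 tail_in_edge_verts[OF True, of G] head_in_edge_verts[OF True, of G]
      by (auto simp: q_def potential_def)
  next
    case False
    then have e2: "e \<in> D2" using e by auto
    let ?t = "tail G e" and ?h = "head G e"
    have \<psi>: "\<psi> e \<in> carrier \<Gamma>" using e2 G2 label_closed by auto
    have t: "q ?t \<otimes> inv (q2 ?t) \<in> ?H" and h: "q ?h \<otimes> inv (q2 ?h) \<in> ?H"
      using e2 qq2 by auto
    have m: "q2 ?t \<otimes> \<psi> e \<otimes> inv (q2 ?h) \<in> ?H" using q2(2) e2 H2 by (auto simp: potential_def)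
    have "(q ?t \<otimes> inv (q2 ?t)) \<otimes> (q2 ?t \<otimes> \<psi> e \<otimes> inv (q2 ?h)) \<otimes> inv (q ?h \<otimes> inv (q2 ?h)) \<in> ?H"
      by (intro subgroup.m_closed[OF S] subgroup.m_inv_closed[OF S] t h m)
    also have "(q ?t \<otimes> inv (q2 ?t)) \<otimes> (q2 ?t \<otimes> \<psi> e \<otimes> inv (q2 ?h)) \<otimes> inv (q ?h \<otimes> inv (q2 ?h)) =
        q ?t \<otimes> \<psi> e \<otimes> inv (q ?h)"
      using q1c q2c \<psi> by (simp add: q_def m_assoc inv_mult_group cancel_simps)
    finally show ?thesis .
  qed
  then have "potential G \<psi> ?H (D1 \<union> D2) q" using q1c q2c by (auto simp: potential_def q_def)
  then have "gain_alpha (D1 \<union> D2) \<le> \<alpha> ?H" using G1 G2 by (intro gain_alpha_le[OF _ S]) auto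
  also have "\<dots> = \<alpha> (?H1 \<union> ?H2)" using c1 c2 by (intro alpha_generate) auto
  also have "\<alpha> (?H1 \<union> ?H2) + \<alpha> (?H1 \<inter> ?H2) \<le> \<alpha> ?H1 + \<alpha> ?H2" using c1 c2 by (rule alpha_submod)
  also have "\<alpha> ?H1 + \<alpha> ?H2 = gain_alpha D1 + gain_alpha D2" using gain_alpha_eq[OF D1 v1] gain_alpha_eq[OF D2 v2] by simp
  finally have 1: "gain_alpha (D1 \<union> D2) + \<alpha> (?H1 \<inter> ?H2) \<le> gain_alpha D1 + gain_alpha D2" by simp
  have CG: "?C \<subseteq> arcs G" using G1 by auto
  have "gg ?C v \<subseteq> ?H1"
    by (rule gain_group_least[OF CG S1 potential_mono[OF q1(2)] q1(1)]) auto
  moreover have "gg ?C v \<subseteq> ?H2"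
    by (rule gain_group_least[OF CG S2 potential_mono[OF q2(2)] q2(1)]) auto
  ultimately have "\<alpha> (gg ?C v) \<le> \<alpha> (?H1 \<inter> ?H2)" using c1 by (intro alpha_mono) auto
  then show ?thesis using 1 gain_alpha_eq[OF C v] by simp
qed

lemma near_balanced_subset:
  assumes "near_bal D" "F \<subseteq> D" "F \<in> conn_sets G"
  shows "bal F \<or> near_bal F"
proof -
  have D: "D \<in> conn_sets G" using assms(1) by (simp add: near_balanced_def)
  show ?thesis
    using assms(1,2) split_potential_mono unfolding near_balanced_iff[OF D] near_balanced_iff[OF assms(3)]
    by blast
qed

lemma capped_alpha_balanced: "F \<subseteq> arcs G \<Longrightarrow> bal F \<Longrightarrow> capped_alpha F = 0"
  using k_ge_1 by (simp add: capped_alpha_def gain_alpha_balanced)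

lemma capped_alpha_le_gain_alpha: "capped_alpha F \<le> gain_alpha F"
  by (simp add: capped_alpha_def)

lemma capped_alpha_range:
  assumes "F \<subseteq> arcs G"
  shows "0 \<le> capped_alpha F" "capped_alpha F \<le> l"
  using gain_alpha_range[OF assms] k_ge_1 by (auto simp: capped_alpha_def)

lemma capped_alpha_mono:
  assumes "F \<subseteq> D" "D \<in> conn_sets G" "F \<in> conn_sets G"
  shows "capped_alpha F \<le> capped_alpha D"
proof (cases "bal F")
  case True
  then show ?thesis
    using capped_alpha_balanced[OF _ True] capped_alpha_range[OF conn_setsD(1)[OF assms(2)]] conn_setsD(1)[OF assms(3)]
    by simp
next
  case False
  then have "near_bal D \<Longrightarrow> near_bal F" using near_balanced_subset[OF _ assms(1,3)] by blast
  then show ?thesis using gain_alpha_mono[OF assms(1,2)] by (auto simp: capped_alpha_def)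
qed

lemma capped_alpha_unbalanced:
  assumes "F \<in> conn_sets G" "\<not> bal F"
  shows "1 \<le> capped_alpha F"
  using gain_alpha_unbalanced[OF assms] k_ge_1 by (simp add: capped_alpha_def)

lemma f_mono:
  assumes "F \<subseteq> D" "D \<in> conn_sets G" "F \<in> conn_sets G"
  shows "f F \<le> f D"
proof -
  have "card (V F) \<le> card (V D)"
    using edge_verts_mono[OF assms(1), of G] finite_subset[OF conn_setsD(1)[OF assms(2)]]
    by (intro card_mono edge_verts_finite) auto
  then have "k * int (card (V F)) \<le> k * int (card (V D))"
    using k_ge_1 by (intro mult_left_mono) auto
  then show ?thesis using capped_alpha_mono[OF assms] by (simp add: f_eq)
qed

end

context gain_graph
begin

section \<open>Comparing two split potentials\<close>

lemma vertex_values_closed: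
  "split_potential F v p g \<Longrightarrow> a \<in> vertex_values p v g x \<Longrightarrow> a \<in> carrier \<Gamma>"
  by (auto simp: split_potential_def vertex_values_def split: if_splits)

lemma split_potential_glue:
  assumes p: "split_potential D1 v p g" and q: "split_potential D2 v q h"
    and agree: "\<And>x. x \<in> V D1 \<inter> V D2 \<Longrightarrow> x \<noteq> v \<Longrightarrow> p x = q x"
    and v: "v \<in> V D2 \<Longrightarrow> {q v, h} \<subseteq> {p v, g}"
  obtains p' where "split_potential (D1 \<union> D2) v p' g"
proof -
  define p' where "p' x = (if x = v then p v else if x \<in> V D1 then p x else q x)" for x
  note pc = split_potentialD(1,2)[OF p] and qc = split_potentialD(1,2)[OF q]
  have 1: "vertex_values p v g x \<subseteq> vertex_values p' v g x" if "x \<in> V D1" for x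
    using that by (auto simp: vertex_values_def p'_def)
  have 2: "vertex_values q v h x \<subseteq> vertex_values p' v g x" if "x \<in> V D2" for x
    using that v agree by (auto simp: vertex_values_def p'_def)
  have "\<exists>a\<in>vertex_values p' v g (tail G e). \<exists>b\<in>vertex_values p' v g (head G e). a \<otimes> \<psi> e = b"
    if e: "e \<in> D1 \<union> D2" for e
  proof (cases "e \<in> D1")
    case True
    then show ?thesis
      using split_potentialD(3)[OF p True] 1[of "tail G e"] 1[of "head G e"] by blast
  next
    case False
    then have "e \<in> D2" using e by auto
    then show ?thesis
      using split_potentialD(3)[OF q, of e] 2[of "tail G e"] 2[of "head G e"] by blast
  qed
  then have "split_potential (D1 \<union> D2) v p' g"
    using pc qc by (simp add: split_potential_def p'_def)
  then show ?thesis by (rule that)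
qed

text \<open>
  The edges whose ends get, in the two split potentials, values that differ by the left factor c.
  These classes provide the decompositions of F at the split vertices.
\<close>

definition ratio_class ::
  "'b set \<Rightarrow> 'a \<Rightarrow> ('a \<Rightarrow> 'g) \<Rightarrow> 'g \<Rightarrow> 'a \<Rightarrow> ('a \<Rightarrow> 'g) \<Rightarrow> 'g \<Rightarrow> 'g \<Rightarrow> 'b set" where
  "ratio_class F v p g u q h c = {e \<in> F.
     \<exists>a\<in>vertex_values p v g (tail G e). \<exists>a'\<in>vertex_values q u h (tail G e).
     \<exists>b\<in>vertex_values p v g (head G e). \<exists>b'\<in>vertex_values q u h (head G e).
       a \<otimes> \<psi> e = b \<and> a' \<otimes> \<psi> e = b' \<and> a = c \<otimes> a' \<and> b = c \<otimes> b'}"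

lemma ratio_class_subset: "ratio_class F v p g u q h c \<subseteq> F"
  by (auto simp: ratio_class_def)

lemma ratio_class_vertex:
  assumes "x \<in> V (ratio_class F v p g u q h c)" "x \<noteq> u" "x \<noteq> v"
  shows "p x = c \<otimes> q x"
  using assms by (auto simp: edge_verts_def ratio_class_def vertex_values_def)

text \<open>
  If all edge ends at v use the same copy, then \<open>p\<close> becomes a potential once v is given the value of
  that copy.
\<close>

lemma potential_update_balanced:
  assumes p: "split_potential F v p g" and w: "w \<in> carrier \<Gamma>" and F': "F' \<subseteq> arcs G"
    and vals: "\<And>e. e \<in> F' \<Longrightarrow> \<exists>a\<in>vertex_values p v g (tail G e). \<exists>b\<in>vertex_values p v g (head G e).
      a \<otimes> \<psi> e = b \<and> (tail G e = v \<longrightarrow> a = w) \<and> (head G e = v \<longrightarrow> b = w)"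
  shows "bal F'"
proof -
  have "(p(v := w)) (tail G e) \<otimes> \<psi> e = (p(v := w)) (head G e)" if "e \<in> F'" for e
    using vals[OF that] by (auto simp: vertex_values_def split: if_splits)
  moreover have "(p(v := w)) x \<in> carrier \<Gamma>" for x using w split_potentialD(1)[OF p] by simp
  ultimately show ?thesis unfolding balanced_iff[OF F'] by blast
qed

context
  fixes F v p g u q h
  assumes F: "F \<subseteq> arcs G" and p: "split_potential F v p g" and q: "split_potential F u q h"
begin

abbreviation cls :: "'g \<Rightarrow> 'b set" where "cls c \<equiv> ratio_class F v p g u q h c"

lemma edge_values:
  assumes "e \<in> F"
  obtains a a' b b' where
    "a \<in> vertex_values p v g (tail G e)" "a' \<in> vertex_values q u h (tail G e)"
    "b \<in> vertex_values p v g (head G e)" "b' \<in> vertex_values q u h (head G e)"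
    "a \<otimes> \<psi> e = b"
    "\<forall>c\<in>carrier \<Gamma>. a = c \<otimes> a' \<longleftrightarrow> b = c \<otimes> b'"
    "\<forall>c\<in>carrier \<Gamma>. a = c \<otimes> a' \<longrightarrow> e \<in> cls c"
proof -
  from split_potentialD(3)[OF p assms] obtain a b where
    a: "a \<in> vertex_values p v g (tail G e)" and b: "b \<in> vertex_values p v g (head G e)"
    and ab: "a \<otimes> \<psi> e = b" by blast
  from split_potentialD(3)[OF q assms] obtain a' b' where
    a': "a' \<in> vertex_values q u h (tail G e)" and b': "b' \<in> vertex_values q u h (head G e)"
    and ab': "a' \<otimes> \<psi> e = b'" by blast
  note c = vertex_values_closed[OF p a] vertex_values_closed[OF p b]
    vertex_values_closed[OF q a'] vertex_values_closed[OF q b']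
  have \<psi>: "\<psi> e \<in> carrier \<Gamma>" using assms F label_closed by auto
  have iff: "a = c \<otimes> a' \<longleftrightarrow> b = c \<otimes> b'" if cc: "c \<in> carrier \<Gamma>" for c
  proof -
    have "c \<otimes> b' = (c \<otimes> a') \<otimes> \<psi> e" using m_assoc[OF cc c(3) \<psi>] ab' by simp
    then have "b = c \<otimes> b' \<longleftrightarrow> a \<otimes> \<psi> e = (c \<otimes> a') \<otimes> \<psi> e" using ab by simp
    then show ?thesis using right_cancel[OF \<psi> c(1) m_closed[OF cc c(3)]] by simp
  qed
  have "e \<in> cls c" if "c \<in> carrier \<Gamma>" "a = c \<otimes> a'" for c
    unfolding ratio_class_def using assms a a' b b' ab ab' that iff[OF that(1)] by blast
  with iff have "\<forall>c\<in>carrier \<Gamma>. a = c \<otimes> a' \<longleftrightarrow> b = c \<otimes> b'"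
    "\<forall>c\<in>carrier \<Gamma>. a = c \<otimes> a' \<longrightarrow> e \<in> cls c" by blast+
  then show ?thesis by (rule that[OF a a' b b' ab])
qed

lemma ratio_class_covers:
  assumes "e \<in> F"
  obtains c where "c \<in> carrier \<Gamma>" "e \<in> cls c"
proof -
  obtain a a' b b' where
    *: "a \<in> vertex_values p v g (tail G e)" "a' \<in> vertex_values q u h (tail G e)"
    "b \<in> vertex_values p v g (head G e)" "b' \<in> vertex_values q u h (head G e)"
    "a \<otimes> \<psi> e = b"
    and iff: "\<forall>c\<in>carrier \<Gamma>. a = c \<otimes> a' \<longleftrightarrow> b = c \<otimes> b'"
    and mem: "\<forall>c\<in>carrier \<Gamma>. a = c \<otimes> a' \<longrightarrow> e \<in> cls c"
    by (rule edge_values[OF assms])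
  note c = vertex_values_closed[OF p *(1)] vertex_values_closed[OF q *(2)]
  show ?thesis using mem that[of "a \<otimes> inv a'"] c by (simp add: m_assoc)
qed

text \<open>
  Both split potentials have a single value at any other vertex, which determines the class of all
  edges there.
\<close>

lemma ratio_class_verts_Int:
  assumes "c \<in> carrier \<Gamma>"
  shows "V (cls c) \<inter> V (F - cls c) \<subseteq> {u, v}"
proof (rule subsetI, rule ccontr)
  fix x assume x: "x \<in> V (cls c) \<inter> V (F - cls c)" "x \<notin> {u, v}"
  then have pq: "p x = c \<otimes> q x" by (intro ratio_class_vertex) auto
  from x obtain e where e: "e \<in> F" "e \<notin> cls c" "tail G e = x \<or> head G e = x"
    by (auto simp: edge_verts_def)
  obtain a a' b b' where
    *: "a \<in> vertex_values p v g (tail G e)" "a' \<in> vertex_values q u h (tail G e)"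
    "b \<in> vertex_values p v g (head G e)" "b' \<in> vertex_values q u h (head G e)"
    "a \<otimes> \<psi> e = b"
    and iff: "\<forall>c\<in>carrier \<Gamma>. a = c \<otimes> a' \<longleftrightarrow> b = c \<otimes> b'"
    and mem: "\<forall>c\<in>carrier \<Gamma>. a = c \<otimes> a' \<longrightarrow> e \<in> cls c"
    by (rule edge_values[OF e(1)])
  have "a \<noteq> c \<otimes> a'" "b \<noteq> c \<otimes> b'" using iff mem assms e(2) by auto
  then show False using * e(3) pq x(2) by (auto simp: vertex_values_def)
qed

end

text \<open>
  The second potential has only one value at v, so the class of \<open>p v\<close> over that value consists of edges
  whose ends at v lie at the first copy of v, while all other edges at v lie at the second copy. Hence
  both parts are balanced.
\<close>

lemma split_distinct_vertices:
  assumes F: "F \<subseteq> arcs G" and p: "split_potential F v p g" and q: "split_potential F u q h"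
    and uv: "u \<noteq> v" and unbal: "\<not> bal F"
  obtains F' F'' where "F = F' \<union> F''" "F' \<noteq> {}" "F'' \<noteq> {}" "bal F'" "bal F''"
    "V F' \<inter> V F'' \<subseteq> {u, v}"
proof -
  \<comment> \<open>the ratio of an edge with an end at the first copy of v\<close>
  define c where "c = p v \<otimes> inv (q v)"
  note pc = split_potentialD(1,2)[OF p] and qc = split_potentialD(1,2)[OF q]
  have cc: "c \<in> carrier \<Gamma>" and cq: "c \<otimes> q v = p v" using pc qc by (simp_all add: c_def m_assoc)
  define F' where "F' = ratio_class F v p g u q h c"
  have F'F: "F' \<subseteq> F" unfolding F'_def by (rule ratio_class_subset)
  have "bal F'"
  proof (rule potential_update_balanced[OF p pc(1)[of v]])
    fix e assume "e \<in> F'"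
    then obtain a a' b b' where "a \<in> vertex_values p v g (tail G e)"
      "a' \<in> vertex_values q u h (tail G e)" "b \<in> vertex_values p v g (head G e)"
      "b' \<in> vertex_values q u h (head G e)" "a \<otimes> \<psi> e = b" "a = c \<otimes> a'" "b = c \<otimes> b'"
      unfolding F'_def ratio_class_def by blast
    moreover have "vertex_values q u h v = {q v}" using uv by (simp add: vertex_values_def)
    ultimately show "\<exists>a\<in>vertex_values p v g (tail G e). \<exists>b\<in>vertex_values p v g (head G e).
      a \<otimes> \<psi> e = b \<and> (tail G e = v \<longrightarrow> a = p v) \<and> (head G e = v \<longrightarrow> b = p v)"
      using cq by (intro bexI[of _ a] bexI[of _ b]) auto
  qed (use F F'F in auto)
  moreover have "bal (F - F')"
  proof (rule potential_update_balanced[OF p pc(2)])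
    fix e assume e: "e \<in> F - F'"
    then have eF: "e \<in> F" by simp
    obtain a a' b b' where *: "a \<in> vertex_values p v g (tail G e)"
      "a' \<in> vertex_values q u h (tail G e)" "b \<in> vertex_values p v g (head G e)"
      "b' \<in> vertex_values q u h (head G e)" "a \<otimes> \<psi> e = b"
      and iff: "\<forall>c\<in>carrier \<Gamma>. a = c \<otimes> a' \<longleftrightarrow> b = c \<otimes> b'"
      and mem: "\<forall>c\<in>carrier \<Gamma>. a = c \<otimes> a' \<longrightarrow> e \<in> ratio_class F v p g u q h c"
      by (rule edge_values[OF F p q eF])
    have "a \<noteq> c \<otimes> a'" "b \<noteq> c \<otimes> b'" using iff mem cc e by (auto simp: F'_def)
    moreover have "vertex_values q u h v = {q v}" using uv by (simp add: vertex_values_def)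
    ultimately have "tail G e = v \<longrightarrow> a = g" "head G e = v \<longrightarrow> b = g"
      using * cq by (auto simp: vertex_values_def)
    then show "\<exists>a\<in>vertex_values p v g (tail G e). \<exists>b\<in>vertex_values p v g (head G e).
      a \<otimes> \<psi> e = b \<and> (tail G e = v \<longrightarrow> a = g) \<and> (head G e = v \<longrightarrow> b = g)"
      using * by blast
  qed (use F in auto)
  moreover have "F' \<noteq> {}" "F - F' \<noteq> {}" using calculation unbal F'F by auto
  moreover have "V F' \<inter> V (F - F') \<subseteq> {u, v}"
    unfolding F'_def by (rule ratio_class_verts_Int[OF F p q cc])
  moreover have "F = F' \<union> (F - F')" using F'F by auto
  ultimately show ?thesis by (intro that[of F' "F - F'"])
qed

text \<open>
  If no ratio class can be separated off as a balanced part, then all edges have the same ratio c, and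
  c matches the values of the copies of v. Indeed an unbalanced class uses both copies in both
  potentials, so its ratio maps \<open>{q v, h}\<close> onto \<open>{p v, g}\<close>. Two different such ratios match the copies in
  opposite orders, which is possible only if g is an involution.
\<close>

lemma split_same_vertex:
  assumes F: "F \<subseteq> arcs G" and ne: "F \<noteq> {}"
    and p: "split_potential F v p g" and q: "split_potential F v q h" and p1: "p v = \<one>"
    and kind: "bal F \<and> h = q v \<or> \<not> bal F \<and> g \<otimes> g \<noteq> \<one>"
    and irred: "\<nexists>F' F''. F = F' \<union> F'' \<and> F' \<noteq> {} \<and> F'' \<noteq> {} \<and> bal F' \<and> V F' \<inter> V F'' \<subseteq> {v}"
  shows "\<exists>c\<in>carrier \<Gamma>. (\<forall>x\<in>V F. x \<noteq> v \<longrightarrow> p x = c \<otimes> q x) \<and>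
    (v \<in> V F \<longrightarrow> {c \<otimes> q v, c \<otimes> h} \<subseteq> {p v, g})"
proof -
  let ?C = "ratio_class F v p g v q h"
  note pc = split_potentialD(1,2)[OF p] and qc = split_potentialD(1,2)[OF q]
  note sub = ratio_class_subset[of F v p g v q h]
  have vals: "p v \<noteq> g \<and> {p v, g} = {c \<otimes> q v, c \<otimes> h}" if c: "c \<in> carrier \<Gamma>" and unb: "\<not> bal (?C c)" for c
  proof (rule ccontr)
    assume neg: "\<not> ?thesis"
    let ?B = "{c \<otimes> q v, c \<otimes> h}"
    have "\<exists>w\<in>{p v, g}. \<forall>a\<in>{p v, g} \<inter> ?B. a = w"
    proof (cases "p v \<in> ?B")
      case True
      have "g \<in> ?B \<longrightarrow> g = p v" using neg True by auto
      then show ?thesis by auto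
    next
      case False
      then show ?thesis by auto
    qed
    then obtain w where w: "w \<in> {p v, g}"
      "\<And>a. a \<in> {p v, g} \<Longrightarrow> a \<in> {c \<otimes> q v, c \<otimes> h} \<Longrightarrow> a = w"
      by blast
    have "bal (?C c)"
    proof (rule potential_update_balanced[OF p, of w])
      fix e assume "e \<in> ?C c"
      then obtain a a' b b' where ab: "a \<in> vertex_values p v g (tail G e)"
        "b \<in> vertex_values p v g (head G e)" "a \<otimes> \<psi> e = b"
        and ab': "a' \<in> vertex_values q v h (tail G e)" "b' \<in> vertex_values q v h (head G e)"
        "a = c \<otimes> a'" "b = c \<otimes> b'"
        unfolding ratio_class_def by blast
      have "tail G e = v \<longrightarrow> a = w"
        using ab(1) ab'(1,3) by (intro impI w(2)) (auto simp: vertex_values_def)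
      moreover have "head G e = v \<longrightarrow> b = w"
        using ab(2) ab'(2,4) by (intro impI w(2)) (auto simp: vertex_values_def)
      ultimately show "\<exists>a\<in>vertex_values p v g (tail G e). \<exists>b\<in>vertex_values p v g (head G e).
        a \<otimes> \<psi> e = b \<and> (tail G e = v \<longrightarrow> a = w) \<and> (head G e = v \<longrightarrow> b = w)"
        using ab by blast
    qed (use w(1) pc F sub[of c] in auto)
    with unb show False ..
  qed
  have proper: "\<not> bal (?C c)" if "c \<in> carrier \<Gamma>" "?C c \<noteq> {}" "?C c \<noteq> F" for c
  proof
    assume "bal (?C c)"
    moreover have "F = ?C c \<union> (F - ?C c)" "F - ?C c \<noteq> {}" using sub[of c] that(3) by blast+
    moreover have "V (?C c) \<inter> V (F - ?C c) \<subseteq> {v}"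
      using ratio_class_verts_Int[OF F p q that(1)] by simp
    ultimately show False using irred that(2) by metis
  qed
  from ne obtain e where e: "e \<in> F" by blast
  obtain c where c: "c \<in> carrier \<Gamma>" "e \<in> ?C c" using ratio_class_covers[OF F p q e] by blast
  have eq: "?C c = F"
  proof (rule ccontr)
    assume neq: "?C c \<noteq> F"
    then have unb: "\<not> bal (?C c)" using proper[OF c(1)] c(2) by auto
    then have unbF: "\<not> bal F" using balanced_mono[OF _ sub F] by blast
    then have g2: "g \<otimes> g \<noteq> \<one>" using kind by blast
    obtain e' where e': "e' \<in> F" "e' \<notin> ?C c" using neq sub by blast
    obtain d where d: "d \<in> carrier \<Gamma>" "e' \<in> ?C d" using ratio_class_covers[OF F p q e'(1)] by blast
    have "\<not> bal (?C d)" using proper[OF d(1)] d(2) unbF by (cases "?C d = F") auto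
    note vd = vals[OF d(1) this] and vc = vals[OF c(1) unb]
    \<comment> \<open>As \<open>c\<close> and \<open>d\<close> are distinct, they send \<open>q v\<close> to different elements of \<open>{p v, g}\<close>.\<close>
    have "c \<noteq> d" using d(2) e'(2) by auto
    then have "c \<otimes> q v \<noteq> d \<otimes> q v" using c d qc by simp
    then have "c \<otimes> q v = \<one> \<and> c \<otimes> h = g \<and> d \<otimes> h = \<one> \<and> d \<otimes> q v = g \<or>
        d \<otimes> q v = \<one> \<and> d \<otimes> h = g \<and> c \<otimes> h = \<one> \<and> c \<otimes> q v = g"
      using vc vd p1 by (auto simp: doubleton_eq_iff)
    then show False
    proof
      assume *: "c \<otimes> q v = \<one> \<and> c \<otimes> h = g \<and> d \<otimes> h = \<one> \<and> d \<otimes> q v = g"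
      then have "inv c = q v" "inv d = h" using c d qc by (auto intro: inv_equality simp: inv_comm)
      then have "h = inv d" "q v = inv c" by auto
      then have "g = c \<otimes> inv d" "g = d \<otimes> inv c" using * by auto
      then have "g \<otimes> g = c \<otimes> inv d \<otimes> (d \<otimes> inv c)" by metis
      then show False using g2 c d by (simp add: m_assoc cancel_simps)
    next
      assume *: "d \<otimes> q v = \<one> \<and> d \<otimes> h = g \<and> c \<otimes> h = \<one> \<and> c \<otimes> q v = g"
      then have "inv d = q v" "inv c = h" using c d qc by (auto intro: inv_equality simp: inv_comm)
      then have "h = inv c" "q v = inv d" by auto
      then have "g = c \<otimes> inv d" "g = d \<otimes> inv c" using * by auto
      then have "g \<otimes> g = c \<otimes> inv d \<otimes> (d \<otimes> inv c)" by metis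
      then show False using g2 c d by (simp add: m_assoc cancel_simps)
    qed
  qed
  show ?thesis
  proof (intro bexI[OF _ c(1)] conjI ballI impI)
    show "p x = c \<otimes> q x" if "x \<in> V F" "x \<noteq> v" for x
      using ratio_class_vertex[of x F v p g v q h c] that eq by auto
    show "{c \<otimes> q v, c \<otimes> h} \<subseteq> {p v, g}" if v: "v \<in> V F"
    proof (cases "bal F")
      case False
      then show ?thesis using vals[OF c(1)] eq by auto
    next
      case True
      then have h: "h = q v" using kind by blast
      from v obtain e where "e \<in> ?C c" "tail G e = v \<or> head G e = v"
        unfolding eq by (auto simp: edge_verts_def)
      then show ?thesis using h by (auto simp: ratio_class_def vertex_values_def)
    qed
  qed
qed

end

section \<open>Exchange from uncrossing\<close>

text \<open>
  The maximal members of the family are disjoint, so J can be compared with I on each of them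
  separately; outside of them J is contained in I.
\<close>

lemma card_le_of_uncrossing_cover:
  fixes \<D> :: "'b set set"
  assumes fin: "finite (I \<union> J)" and sub: "\<And>D. D \<in> \<D> \<Longrightarrow> D \<subseteq> I \<union> J"
    and union: "\<And>D D'. D \<in> \<D> \<Longrightarrow> D' \<in> \<D> \<Longrightarrow> D \<inter> D' \<noteq> {} \<Longrightarrow> D \<union> D' \<in> \<D>"
    and card: "\<And>D. D \<in> \<D> \<Longrightarrow> card (J \<inter> D) \<le> card (I \<inter> D)"
    and cover: "J - I \<subseteq> \<Union>\<D>"
  shows "card J \<le> card I"
proof -
  define \<M> where "\<M> = {D \<in> \<D>. \<forall>D'\<in>\<D>. D \<subseteq> D' \<longrightarrow> D' = D}"
  have finD: "finite \<D>" using finite_subset[of \<D> "Pow (I \<union> J)"] fin sub by auto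
  have finM: "finite \<M>" using finD by (simp add: \<M>_def)
  have fI: "finite I" and fJ: "finite J" using fin by auto
  have disj: "D \<inter> D' = {}" if "D \<in> \<M>" "D' \<in> \<M>" "D \<noteq> D'" for D D'
  proof (rule ccontr)
    assume ne: "D \<inter> D' \<noteq> {}"
    have DD: "D \<in> \<D>" "D' \<in> \<D>" using that by (auto simp: \<M>_def)
    have "D \<union> D' \<in> \<D>" by (rule union[OF DD ne])
    moreover have "D \<subseteq> D \<union> D'" "D' \<subseteq> D \<union> D'" by auto
    ultimately have "D \<union> D' = D" "D \<union> D' = D'" using that unfolding \<M>_def by blast+
    with that(3) show False by simp
  qed
  have above: "\<exists>M\<in>\<M>. D \<subseteq> M" if D: "D \<in> \<D>" for D
  proof -
    obtain M where "M \<in> \<D>" "D \<subseteq> M" "\<forall>D'\<in>\<D>. M \<subseteq> D' \<longrightarrow> M = D'"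
      using finite_has_maximal2[OF finD D] by blast
    then show ?thesis unfolding \<M>_def by blast
  qed
  have cover': "J - \<Union>\<M> \<subseteq> I - \<Union>\<M>" using cover above by blast
  have split: "card K = (\<Sum>D\<in>\<M>. card (K \<inter> D)) + card (K - \<Union>\<M>)" if K: "finite K" for K
  proof -
    have "card (\<Union>D\<in>\<M>. K \<inter> D) = (\<Sum>D\<in>\<M>. card (K \<inter> D))"
      using finM K disj by (intro card_UN_disjoint) auto
    moreover have "(\<Union>D\<in>\<M>. K \<inter> D) = K \<inter> \<Union>\<M>" by auto
    moreover have "card K = card (K \<inter> \<Union>\<M>) + card (K - \<Union>\<M>)"
      using card_Un_disjoint[of "K \<inter> \<Union>\<M>" "K - \<Union>\<M>"] K by (simp add: Int_Diff_Un Int_Diff_disjoint)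
    ultimately show ?thesis by simp
  qed
  have "(\<Sum>D\<in>\<M>. card (J \<inter> D)) \<le> (\<Sum>D\<in>\<M>. card (I \<inter> D))"
    using card by (intro sum_mono) (auto simp: \<M>_def)
  moreover have "card (J - \<Union>\<M>) \<le> card (I - \<Union>\<M>)" using cover' fI by (intro card_mono) auto
  ultimately show ?thesis using split[OF fI] split[OF fJ] by linarith
qed

context count_data
begin

section \<open>Counting independent edges\<close>

abbreviation indep :: "'b set \<Rightarrow> bool" where
  "indep I \<equiv> I \<in> indep_alpha \<Gamma> G \<psi> \<alpha> k l"

lemma indep_iff: "indep I \<longleftrightarrow> I \<subseteq> arcs G \<and> (\<forall>F\<in>conn_sets G. F \<subseteq> I \<longrightarrow> int (card F) \<le> f F)"
  by (auto simp: indep_alpha_def)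

text \<open>
  No edge of the set is dependent by itself. This excludes the sets on which f is not positive, where
  bounds in terms of f fail for an empty intersection with an independent set: if \<open>l = k + 1\<close> and X
  consists of balanced loops at one vertex, then \<open>f X = - 1\<close>.
\<close>

definition matroid_loopless :: "'b set \<Rightarrow> bool" where
  "matroid_loopless E' \<longleftrightarrow> E' \<subseteq> arcs G \<and> (\<forall>e\<in>E'. 1 \<le> f {e})"

lemma finite_edges: "F \<subseteq> arcs G \<Longrightarrow> finite F"
  using finite_arcs finite_subset by blast

lemma finite_V: "F \<subseteq> arcs G \<Longrightarrow> finite (V F)"
  by (simp add: edge_verts_finite finite_edges)

text \<open>
  Adding up the bounds for the components of X, every component after the first one contributes a
  further \<open>a - l \<le> 0\<close>.
\<close>

lemma indep_card_le:
  assumes "indep I" "X \<subseteq> I" "X \<noteq> {}" "a \<le> l"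
    and "\<And>Z. Z \<in> conn_sets G \<Longrightarrow> Z \<subseteq> X \<Longrightarrow> capped_alpha Z \<le> a"
  shows "int (card X) \<le> k * int (card (V X)) - l + a"
  using assms(2-5)
proof (induction "card X" arbitrary: X rule: less_induct)
  case less
  have IG: "I \<subseteq> arcs G" and If: "\<And>F. F \<in> conn_sets G \<Longrightarrow> F \<subseteq> I \<Longrightarrow> int (card F) \<le> f F"
    using assms(1) by (auto simp: indep_iff)
  have XG: "X \<subseteq> arcs G" using less.prems(1) IG by auto
  note finX = finite_edges[OF XG]
  obtain Z where Z: "Z \<in> conn_sets G" "Z \<subseteq> X" "V Z \<inter> V (X - Z) = {}"
    using conn_component_exists[OF finX XG less.prems(2)] by blast
  have "int (card Z) \<le> f Z" using If Z less.prems(1) by auto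
  also have "\<dots> \<le> k * int (card (V Z)) - l + a" using less.prems(4)[OF Z(1,2)] by (simp add: f_eq)
  finally have cZ: "int (card Z) \<le> k * int (card (V Z)) - l + a" .
  show ?case
  proof (cases "X - Z = {}")
    case True
    then have "X = Z" using Z by auto
    then show ?thesis using cZ by simp
  next
    case False
    have finZ: "finite Z" using Z(2) finX finite_subset by blast
    have "card (X - Z) < card X"
      using Z conn_setsD(2)[OF Z(1)] finX by (intro psubset_card_mono) auto
    then have "int (card (X - Z)) \<le> k * int (card (V (X - Z))) - l + a"
      by (rule less.hyps) (use less.prems False in auto)
    moreover have "card X = card Z + card (X - Z)"
      using Z(2) finX finZ by (simp add: card_Diff_subset card_mono)
    moreover have "card (V X) = card (V Z) + card (V (X - Z))"
    proof -
      have "X = Z \<union> (X - Z)" using Z by auto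
      then have "V X = V Z \<union> V (X - Z)" by (metis edge_verts_Un)
      then show ?thesis using Z(3) XG Z(2) by (simp add: card_Un_disjoint finite_V subset_iff)
    qed
    ultimately show ?thesis using cZ less.prems(3) by (simp add: algebra_simps)
  qed
qed

lemma card_V_mono: "X \<subseteq> Y \<Longrightarrow> Y \<subseteq> arcs G \<Longrightarrow> k * int (card (V X)) \<le> k * int (card (V Y))"
  using k_ge_1 by (intro mult_left_mono) (auto intro!: card_mono finite_V dest: edge_verts_mono[of X Y G])

lemma indep_Int_card_le:
  assumes I: "indep I" and E': "matroid_loopless E'" and X: "X \<subseteq> E'" "X \<noteq> {}" and a: "a \<le> l"
    and ap: "\<And>Z. Z \<in> conn_sets G \<Longrightarrow> Z \<subseteq> X \<Longrightarrow> capped_alpha Z \<le> a"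
  shows "int (card (I \<inter> X)) \<le> k * int (card (V X)) - l + a"
proof -
  have XG: "X \<subseteq> arcs G" using X E' by (auto simp: matroid_loopless_def)
  show ?thesis
  proof (cases "I \<inter> X = {}")
    case True
    obtain e where e: "e \<in> X" using X by blast
    then have eG: "{e} \<in> conn_sets G" using XG by (intro conn_sets_single) auto
    have "1 \<le> f {e}" using e X E' by (auto simp: matroid_loopless_def)
    then have "0 \<le> f {e}" by simp
    also have "\<dots> \<le> k * int (card (V {e})) - l + a" using ap[OF eG] e by (simp add: f_eq)
    also have "\<dots> \<le> k * int (card (V X)) - l + a" using card_V_mono[of "{e}" X] e XG by simp
    finally show ?thesis using True by simp
  next
    case False
    have "int (card (I \<inter> X)) \<le> k * int (card (V (I \<inter> X))) - l + a"
      by (rule indep_card_le[OF I _ False a]) (use ap in auto)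
    then show ?thesis using card_V_mono[of "I \<inter> X" X] XG by simp
  qed
qed

lemma indep_Int_card_le_conn:
  assumes "indep I" "matroid_loopless E'" "X \<subseteq> D" "X \<noteq> {}" "D \<subseteq> E'" "D \<in> conn_sets G"
  shows "int (card (I \<inter> X)) \<le> k * int (card (V X)) - l + capped_alpha D"
  by (rule indep_Int_card_le[OF assms(1,2)])
    (use assms capped_alpha_mono[of _ D] capped_alpha_range[OF conn_setsD(1)[OF assms(6)]] in auto)

lemma indep_Int_card_le_f:
  assumes "indep I" "matroid_loopless E'" "D \<subseteq> E'" "D \<in> conn_sets G"
  shows "int (card (I \<inter> D)) \<le> f D"
  using indep_Int_card_le_conn[of I E' D D] assms conn_setsD(2)[of D G] by (simp add: f_eq)

lemma indep_Int_card_le_balanced: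
  assumes "indep I" "matroid_loopless E'" "X \<subseteq> E'" "X \<noteq> {}" "bal X"
  shows "int (card (I \<inter> X)) \<le> k * int (card (V X)) - l"
proof -
  have XG: "X \<subseteq> arcs G" using assms by (auto simp: matroid_loopless_def)
  have "capped_alpha Z \<le> 0" if "Z \<in> conn_sets G" "Z \<subseteq> X" for Z
    using capped_alpha_balanced[of Z] balanced_mono[OF assms(5) that(2) XG] that XG by auto
  then show ?thesis using indep_Int_card_le[OF assms(1-4), of 0] l_nonneg by simp
qed

lemma card_V_Un:
  assumes "X \<subseteq> arcs G" "Y \<subseteq> arcs G"
  shows "k * int (card (V (X \<union> Y))) + k * int (card (V X \<inter> V Y)) =
    k * int (card (V X)) + k * int (card (V Y))"
proof -
  have "int (card (V (X \<union> Y))) + int (card (V X \<inter> V Y)) = int (card (V X)) + int (card (V Y))"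
    using card_Un_Int[OF finite_V[OF assms(1)] finite_V[OF assms(2)]] by simp
  then show ?thesis by (simp flip: distrib_left)
qed

lemma card_Int_Un_le: "finite C \<Longrightarrow> C = X \<union> Y \<Longrightarrow> int (card (I \<inter> C)) \<le> int (card (I \<inter> X)) + int (card (I \<inter> Y))"
  using card_Un_le[of "I \<inter> X" "I \<inter> Y"] by (simp add: Int_Un_distrib)

text \<open>
  Bounding the two parts separately counts the common vertex twice and subtracts l twice, which changes
  the bound by \<open>k - l = - 1\<close>.
\<close>

lemma not_tight_of_articulation:
  assumes I: "indep I" and E': "matroid_loopless E'" and C: "C \<in> conn_sets G" "C \<subseteq> E'" and l: "l = k + 1"
    and parts: "C = X \<union> Y" "X \<noteq> {}" "Y \<noteq> {}" "bal X" and cut: "V X \<inter> V Y \<subseteq> {v}"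
  shows "int (card (I \<inter> C)) \<le> f C - 1"
proof -
  note CG = conn_setsD(1)[OF C(1)]
  have XY: "X \<subseteq> arcs G" "Y \<subseteq> arcs G" using CG parts by auto
  have "card (V X \<inter> V Y) \<le> 1" using card_mono[OF _ cut] by simp
  then have "k * int (card (V X \<inter> V Y)) \<le> k * 1" using k_ge_1 by (intro mult_left_mono) auto
  then have "k * int (card (V X)) + k * int (card (V Y)) \<le> k * int (card (V C)) + k"
    using card_V_Un[OF XY] parts(1) by simp
  moreover have "int (card (I \<inter> X)) \<le> k * int (card (V X)) - l"
    using parts C by (intro indep_Int_card_le_balanced[OF I E']) auto
  moreover have "int (card (I \<inter> Y)) \<le> k * int (card (V Y)) - l + capped_alpha C"
    using parts C by (intro indep_Int_card_le_conn[OF I E']) auto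
  moreover note card_Int_Un_le[OF finite_edges[OF CG] parts(1), of I]
  ultimately show ?thesis unfolding f_eq using l by linarith
qed

text \<open>
  The separate bounds add up to \<open>k * (card (V C) + 2) - 2 * l = k * card (V C) - 2\<close>, whereas \<open>f C\<close> is at
  least \<open>k * card (V C) - l + k = k * card (V C) - 1\<close>.
\<close>

lemma not_tight_of_balanced_two_cut:
  assumes I: "indep I" and E': "matroid_loopless E'" and C: "C \<in> conn_sets G" "C \<subseteq> E'" and l: "l = k + 1"
    and parts: "C = X \<union> Y" "X \<noteq> {}" "Y \<noteq> {}" "bal X" "bal Y" and cut: "V X \<inter> V Y \<subseteq> {u, v}"
    and k: "k \<le> capped_alpha C"
  shows "int (card (I \<inter> C)) \<le> f C - 1"
proof -
  note CG = conn_setsD(1)[OF C(1)]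
  have XY: "X \<subseteq> arcs G" "Y \<subseteq> arcs G" using CG parts by auto
  have "card (V X \<inter> V Y) \<le> card {u, v}" using cut by (intro card_mono) auto
  also have "\<dots> \<le> 2" by (simp add: card_insert_if)
  finally have "k * int (card (V X \<inter> V Y)) \<le> k * 2" using k_ge_1 by (intro mult_left_mono) auto
  then have "k * int (card (V X)) + k * int (card (V Y)) \<le> k * int (card (V C)) + 2 * k"
    using card_V_Un[OF XY] parts(1) by simp
  moreover have "int (card (I \<inter> X)) \<le> k * int (card (V X)) - l"
    using parts C by (intro indep_Int_card_le_balanced[OF I E']) auto
  moreover have "int (card (I \<inter> Y)) \<le> k * int (card (V Y)) - l"
    using parts C by (intro indep_Int_card_le_balanced[OF I E']) auto
  moreover note card_Int_Un_le[OF finite_edges[OF CG] parts(1), of I]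
  ultimately show ?thesis unfolding f_eq using l k by linarith
qed

section \<open>Uncrossing\<close>

lemma near_balancedE:
  assumes "near_bal F"
  obtains v p g where "split_potential F v p g" "p v = \<one>"
proof -
  have F: "F \<in> conn_sets G" using assms by (simp add: near_balanced_def)
  obtain v p g where pg: "split_potential F v p g" using assms near_balanced_iff[OF F] by blast
  have c: "p v \<in> carrier \<Gamma>" using split_potentialD(1)[OF pg] .
  then have "split_potential F v (\<lambda>x. inv (p v) \<otimes> p x) (inv (p v) \<otimes> g)"
    using split_potential_translate[OF conn_setsD(1)[OF F] pg] by simp
  then show ?thesis by (rule that) (use c in simp)
qed

lemma capped_alpha_near_balanced: "F \<in> conn_sets G \<Longrightarrow> split_potential F v p g \<Longrightarrow> capped_alpha F \<le> k"
  using near_balanced_iff[of F] capped_alpha_balanced[of F] conn_setsD(1)[of F G] k_ge_1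
  by (cases "bal F") (auto simp: capped_alpha_def)

text \<open>
  This is the case in which capping the value of D1 could violate submodularity. A set C that meets
  the bound for I cannot be decomposed as in \<open>not_tight_of_articulation\<close> and
  \<open>not_tight_of_balanced_two_cut\<close>. Hence D2 is balanced, or
  near-balanced with the same split vertex as D1, and the two splits agree on C. They then combine to
  a split of the union.
\<close>

lemma capped_alpha_Un_le_of_tight:
  assumes I: "indep I" and E': "matroid_loopless E'"
    and D1: "D1 \<in> conn_sets G" "D1 \<subseteq> E'" and D2: "D2 \<in> conn_sets G" "D2 \<subseteq> E'"
    and C: "C \<in> conn_sets G" "C = D1 \<inter> D2" "V C = V D1 \<inter> V D2"
    and near: "near_bal D1" and big: "k < gain_alpha D1"
    and eq: "capped_alpha D2 = capped_alpha C"
    and tight: "\<not> int (card (I \<inter> C)) \<le> f C - 1"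
  shows "capped_alpha (D1 \<union> D2) \<le> k"
proof -
  note G1 = conn_setsD(1)[OF D1(1)] and G2 = conn_setsD(1)[OF D2(1)] and CG = conn_setsD(1)[OF C(1)]
  have CE: "C \<subseteq> E'" and C1: "C \<subseteq> D1" and C2: "C \<subseteq> D2" using C D1 by auto
  have l: "l = k + 1" using big gain_alpha_range[OF G1] l_le by linarith
  obtain v p g where p: "split_potential D1 v p g" and p1: "p v = \<one>"
    using near_balancedE[OF near] by blast
  note pc = split_potentialD(1,2)[OF p]
  have ag: "k < \<alpha> {g}" using gain_alpha_split_le[OF D1(1) p p1] big by linarith
  have g1: "g \<noteq> \<one>" using ag alpha_one k_ge_1 by auto
  have g2: "g \<otimes> g \<noteq> \<one>" using alpha_involution_le[OF pc(2) g1] ag by linarith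
  note pC = split_potential_mono[OF p C1]
  have irred: "\<nexists>X Y. C = X \<union> Y \<and> X \<noteq> {} \<and> Y \<noteq> {} \<and> bal X \<and> V X \<inter> V Y \<subseteq> {v}"
    using not_tight_of_articulation[OF I E' C(1) CE l] tight by metis
  \<comment> \<open>A balanced D2 is treated as split at v with the same value at both copies.\<close>
  have "\<exists>q h. split_potential D2 v q h \<and> (bal C \<and> h = q v \<or> \<not> bal C \<and> g \<otimes> g \<noteq> \<one>)"
  proof (cases "bal C")
    case True
    then have "capped_alpha D2 = 0" using eq capped_alpha_balanced[OF CG] by simp
    then have "bal D2" using capped_alpha_unbalanced[OF D2(1)] by fastforce
    then obtain q where "\<forall>x. q x \<in> carrier \<Gamma>" "\<forall>e\<in>D2. q (tail G e) \<otimes> \<psi> e = q (head G e)"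
      using balanced_iff[OF G2] by blast
    moreover have "vertex_values q v (q v) x = {q x}" for x by (simp add: vertex_values_def)
    ultimately have "split_potential D2 v q (q v)" by (simp add: split_potential_def)
    then show ?thesis using True by blast
  next
    case False
    have aC: "k < gain_alpha C" using gain_alpha_split_ge[OF C(1) False pC p1] ag by linarith
    have nC: "near_bal C" using near_balanced_subset[OF near C1 C(1)] False by blast
    then have kC: "capped_alpha C = k" using aC by (simp add: capped_alpha_def)
    moreover have "k < gain_alpha D2" using aC gain_alpha_mono[OF C2 D2(1)] by linarith
    ultimately have "near_bal D2" using eq by (auto simp: capped_alpha_def split: if_splits)
    then obtain u q h where q: "split_potential D2 u q h" using near_balancedE by blast
    have "u = v"
    proof (rule ccontr)
      assume uv: "u \<noteq> v"
      obtain X Y where XY: "C = X \<union> Y" "X \<noteq> {}" "Y \<noteq> {}" "bal X" "bal Y" "V X \<inter> V Y \<subseteq> {u, v}"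
        by (rule split_distinct_vertices[OF CG pC split_potential_mono[OF q C2] uv False])
      show False using not_tight_of_balanced_two_cut[OF I E' C(1) CE l XY] kC tight by simp
    qed
    then show ?thesis using q False g2 by blast
  qed
  then obtain q h where q: "split_potential D2 v q h"
    and kind: "bal C \<and> h = q v \<or> \<not> bal C \<and> g \<otimes> g \<noteq> \<one>" by blast
  obtain c where c: "c \<in> carrier \<Gamma>"
    and agree: "\<forall>x\<in>V C. x \<noteq> v \<longrightarrow> p x = c \<otimes> q x"
    and atv: "v \<in> V C \<longrightarrow> {c \<otimes> q v, c \<otimes> h} \<subseteq> {p v, g}"
    using split_same_vertex[OF CG conn_setsD(2)[OF C(1)] pC split_potential_mono[OF q C2] p1 kind irred]
    by blast
  note q' = split_potential_translate[OF G2 q c]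
  have "v \<in> V D1"
    using balanced_split_potential[OF G1 p] near by (auto simp: near_balanced_def)
  then have "v \<in> V D2 \<Longrightarrow> {c \<otimes> q v, c \<otimes> h} \<subseteq> {p v, g}" using atv C(3) by simp
  then obtain p' where p': "split_potential (D1 \<union> D2) v p' g"
    using split_potential_glue[OF p q'] agree C(3) by (metis (no_types, lifting))
  have "D1 \<union> D2 \<in> conn_sets G"
    using D1 D2 C(3) edge_verts_nonempty[OF conn_setsD(2)[OF C(1)], of G] by (intro conn_sets_Un) auto
  then show ?thesis using p' by (rule capped_alpha_near_balanced)
qed

text \<open>
  As \<open>capped_alpha\<close> is at most \<open>k + 1\<close>, and equal to k for a near-balanced set whose value is capped, it
  violates submodularity by at most one, and then the bound on C is missed by at least one.
\<close>

lemma uncross_connected: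
  assumes I: "indep I" and E': "matroid_loopless E'"
    and D1: "D1 \<in> conn_sets G" "D1 \<subseteq> E'" and D2: "D2 \<in> conn_sets G" "D2 \<subseteq> E'"
    and C: "C \<in> conn_sets G" "C = D1 \<inter> D2" "V C = V D1 \<inter> V D2"
  shows "int (card (I \<inter> C)) + capped_alpha (D1 \<union> D2) \<le>
    k * int (card (V C)) - l + capped_alpha D1 + capped_alpha D2"
proof -
  note G1 = conn_setsD(1)[OF D1(1)] and G2 = conn_setsD(1)[OF D2(1)]
  have CE: "C \<subseteq> E'" and C1: "C \<subseteq> D1" and C2: "C \<subseteq> D2" using C D1 by auto
  have leC: "int (card (I \<inter> C)) \<le> k * int (card (V C)) - l + capped_alpha C"
    using indep_Int_card_le_f[OF I E' CE C(1)] by (simp add: f_eq)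
  have mono: "capped_alpha C \<le> capped_alpha D1" "capped_alpha C \<le> capped_alpha D2"
    using capped_alpha_mono[OF C1 D1(1) C(1)] capped_alpha_mono[OF C2 D2(1) C(1)] .
  have U: "capped_alpha (D1 \<union> D2) \<le> k + 1" using capped_alpha_range[of "D1 \<union> D2"] G1 G2 l_le by simp
  have exceptional: ?thesis
    if near: "near_bal D" and big: "k < gain_alpha D"
      and D: "D \<in> conn_sets G" "D \<subseteq> E'" and D': "D' \<in> conn_sets G" "D' \<subseteq> E'"
      and CD: "C = D \<inter> D'" "V C = V D \<inter> V D'" and un: "D \<union> D' = D1 \<union> D2"
      and ap: "capped_alpha D1 + capped_alpha D2 = capped_alpha D + capped_alpha D'"
      and mono: "capped_alpha C \<le> capped_alpha D'" for D D'
  proof -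
    have k: "capped_alpha D = k" using near big by (simp add: capped_alpha_def)
    show ?thesis
    proof (cases "capped_alpha D' = capped_alpha C \<and> \<not> int (card (I \<inter> C)) \<le> f C - 1")
      case True
      then have "capped_alpha (D1 \<union> D2) \<le> k"
        using capped_alpha_Un_le_of_tight[OF I E' D D' C(1) CD near big] un by simp
      then show ?thesis using leC k ap mono by linarith
    next
      case False
      then show ?thesis using leC U k ap mono by (auto simp: f_eq)
    qed
  qed
  have plain: "capped_alpha D = gain_alpha D" if "\<not> (near_bal D \<and> k < gain_alpha D)" for D
    using that by (auto simp: capped_alpha_def)
  consider "near_bal D1 \<and> k < gain_alpha D1" | "near_bal D2 \<and> k < gain_alpha D2"
    | "capped_alpha D1 = gain_alpha D1 \<and> capped_alpha D2 = gain_alpha D2"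
    using plain by blast
  then show ?thesis
  proof cases
    case 1
    then show ?thesis using exceptional[of D1 D2] D1 D2 C mono by simp
  next
    case 2
    then show ?thesis using exceptional[of D2 D1] D1 D2 C mono by (simp add: Un_commute Int_commute)
  next
    case 3
    have "gain_alpha (D1 \<union> D2) + gain_alpha C \<le> gain_alpha D1 + gain_alpha D2"
      using gain_alpha_submodular[OF D1(1) D2(1)] C by simp
    then show ?thesis
      using 3 leC capped_alpha_le_gain_alpha[of C] capped_alpha_le_gain_alpha[of "D1 \<union> D2"]
      by linarith
  qed
qed

text \<open>
  The potentials of D1 and D2 can be made to agree on the connected set C. The only vertex where they
  may still disagree is u, and splitting the union there separates D1 from D2.
\<close>

lemma capped_alpha_Un_le_of_balanced:
  assumes D1: "D1 \<in> conn_sets G" "bal D1" and D2: "D2 \<in> conn_sets G" "bal D2"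
    and C: "C \<in> conn_sets G" "C \<subseteq> D1 \<inter> D2" and W: "V D1 \<inter> V D2 \<subseteq> insert u (V C)" "u \<notin> V C"
  shows "capped_alpha (D1 \<union> D2) \<le> k"
proof -
  note G1 = conn_setsD(1)[OF D1(1)] and G2 = conn_setsD(1)[OF D2(1)]
  obtain p where p: "\<forall>x. p x \<in> carrier \<Gamma>" "\<forall>e\<in>D1. p (tail G e) \<otimes> \<psi> e = p (head G e)"
    using D1(2) balanced_iff[OF G1] by blast
  obtain q where q: "\<forall>x. q x \<in> carrier \<Gamma>" "\<forall>e\<in>D2. q (tail G e) \<otimes> \<psi> e = q (head G e)"
    using D2(2) balanced_iff[OF G2] by blast
  obtain w where w: "w \<in> V C" using edge_verts_nonempty[OF conn_setsD(2)[OF C(1)], of G] by blast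
  define c where "c = p w \<otimes> inv (q w)"
  have c: "c \<in> carrier \<Gamma>" "p w = c \<otimes> q w" using p q by (simp_all add: c_def m_assoc)
  have "V C \<subseteq> {x. p x = c \<otimes> q x}"
  proof (rule conn_sets_cut_closed[OF C(1) w])
    fix e assume e: "e \<in> C"
    then have \<psi>: "\<psi> e \<in> carrier \<Gamma>" using conn_setsD(1)[OF C(1)] label_closed by auto
    have ph: "p (head G e) = p (tail G e) \<otimes> \<psi> e" and qh: "q (head G e) = q (tail G e) \<otimes> \<psi> e"
      using e C(2) p(2) q(2) by auto
    have "c \<otimes> q (head G e) = c \<otimes> q (tail G e) \<otimes> \<psi> e"
      unfolding qh using c \<psi> q by (simp add: m_assoc)
    then show "tail G e \<in> {x. p x = c \<otimes> q x} \<longleftrightarrow> head G e \<in> {x. p x = c \<otimes> q x}"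
      unfolding ph mem_Collect_eq using c \<psi> p q by simp
  qed (use c in simp)
  then have agree: "p x = c \<otimes> q x" if "x \<in> V D1 \<inter> V D2" "x \<noteq> u" for x using W that by blast
  have "\<exists>a\<in>vertex_values p u (c \<otimes> q u) (tail G e). \<exists>b\<in>vertex_values p u (c \<otimes> q u) (head G e).
      a \<otimes> \<psi> e = b" if "e \<in> D1" for e
    using that p(2) by (intro bexI[of _ "p (tail G e)"] bexI[of _ "p (head G e)"])
      (auto simp: vertex_values_def)
  then have sp: "split_potential D1 u p (c \<otimes> q u)" using p q c by (simp add: split_potential_def)
  have "\<exists>a\<in>vertex_values q u (q u) (tail G e). \<exists>b\<in>vertex_values q u (q u) (head G e).
      a \<otimes> \<psi> e = b" if "e \<in> D2" for e
    using that q(2) by (intro bexI[of _ "q (tail G e)"] bexI[of _ "q (head G e)"])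
      (auto simp: vertex_values_def)
  then have "split_potential D2 u q (q u)" using q by (simp add: split_potential_def)
  then have sq: "split_potential D2 u (\<lambda>x. c \<otimes> q x) (c \<otimes> q u)"
    by (rule split_potential_translate[OF G2 _ c(1)])
  obtain p' where p': "split_potential (D1 \<union> D2) u p' (c \<otimes> q u)"
    by (rule split_potential_glue[OF sp sq]) (use agree in auto)
  have "w \<in> V D1 \<inter> V D2" using w C(2) edge_verts_mono[of C D1 G] edge_verts_mono[of C D2 G] by auto
  then have "D1 \<union> D2 \<in> conn_sets G" by (intro conn_sets_Un[OF D1(1) D2(1)]) auto
  then show ?thesis using p' by (rule capped_alpha_near_balanced)
qed

text \<open>
  Besides the case of a connected intersection containing all common vertices, this is a count: a
  second component contributes another \<open>- l\<close>, and a common vertex that is not covered by the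
  intersection contributes \<open>k\<close>. The only case with insufficient slack is that of two balanced sets and a
  single uncovered vertex, with \<open>l = k + 1\<close>.
\<close>

lemma uncross:
  assumes I: "indep I" and E': "matroid_loopless E'"
    and D1: "D1 \<in> conn_sets G" "D1 \<subseteq> E'" and D2: "D2 \<in> conn_sets G" "D2 \<subseteq> E'"
    and meet: "D1 \<inter> D2 \<noteq> {}"
  shows "int (card (I \<inter> (D1 \<inter> D2))) + f (D1 \<union> D2) \<le> f D1 + f D2"
proof -
  note G1 = conn_setsD(1)[OF D1(1)] and G2 = conn_setsD(1)[OF D2(1)]
  let ?X = "D1 \<inter> D2" and ?W = "V D1 \<inter> V D2"
  have XG: "?X \<subseteq> arcs G" and XE: "?X \<subseteq> E'" using G1 D1 by auto
  have XW: "V ?X \<subseteq> ?W" using edge_verts_mono[of ?X D1 G] edge_verts_mono[of ?X D2 G] by auto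
  have finW: "finite ?W" using finite_V[OF G1] by simp
  have U: "capped_alpha (D1 \<union> D2) \<le> l" using capped_alpha_range[of "D1 \<union> D2"] G1 G2 by simp
  note pos1 = capped_alpha_range(1)[OF G1] and pos2 = capped_alpha_range(1)[OF G2]
  have "int (card (I \<inter> ?X)) + capped_alpha (D1 \<union> D2) \<le>
    k * int (card ?W) - l + capped_alpha D1 + capped_alpha D2"
  proof (cases "?X \<in> conn_sets G")
    case conn: True
    show ?thesis
    proof (cases "V ?X = ?W")
      case True
      then show ?thesis using uncross_connected[OF I E' D1 D2 conn refl] by simp
    next
      case False
      then obtain u where u: "u \<in> ?W" "u \<notin> V ?X" using XW by blast
      have le1: "int (card (I \<inter> ?X)) \<le> k * int (card (V ?X)) - l + capped_alpha D1"
        by (rule indep_Int_card_le_conn[OF I E' _ meet D1(2,1)]) simp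
      have le2: "int (card (I \<inter> ?X)) \<le> k * int (card (V ?X)) - l + capped_alpha D2"
        by (rule indep_Int_card_le_conn[OF I E' _ meet D2(2,1)]) simp
      have iW: "insert u (V ?X) \<subseteq> ?W" using u XW by blast
      have ci: "card (insert u (V ?X)) = card (V ?X) + 1" using u finite_V[OF XG] by simp
      have "k * int (card (V ?X) + 1) \<le> k * int (card ?W)"
        using card_mono[OF finW iW] ci k_ge_1 by (intro mult_left_mono) auto
      then have kW: "k * int (card (V ?X)) + k \<le> k * int (card ?W)" by (simp add: algebra_simps)
      show ?thesis
      proof (cases "capped_alpha (D1 \<union> D2) \<le> k \<or> capped_alpha D1 \<ge> 1 \<or> capped_alpha D2 \<ge> 1")
        case True
        then show ?thesis using le1 le2 kW U l_le pos1 pos2 by linarith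
      next
        case nle: False
        then have b: "bal D1" "bal D2"
          using capped_alpha_unbalanced[OF D1(1)] capped_alpha_unbalanced[OF D2(1)] by blast+
        have "\<not> ?W \<subseteq> insert u (V ?X)"
          using capped_alpha_Un_le_of_balanced[OF D1(1) b(1) D2(1) b(2) conn subset_refl _ u(2)] nle by blast
        then obtain u' where u': "u' \<in> ?W" "u' \<notin> insert u (V ?X)" by blast
        have iW': "insert u' (insert u (V ?X)) \<subseteq> ?W" using u' iW by blast
        have "card (insert u' (insert u (V ?X))) = card (V ?X) + 2"
          using u' ci finite_V[OF XG] by simp
        then have "k * int (card (V ?X) + 2) \<le> k * int (card ?W)"
          using card_mono[OF finW iW'] k_ge_1 by (intro mult_left_mono) auto
        then have "k * int (card (V ?X)) + 2 * k \<le> k * int (card ?W)" by (simp add: algebra_simps)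
        then show ?thesis using le1 U l_le pos1 pos2 k_ge_1 by linarith
      qed
    qed
  next
    case False
    obtain Z where Z: "Z \<in> conn_sets G" "Z \<subseteq> ?X" "V Z \<inter> V (?X - Z) = {}"
      using conn_component_exists[OF finite_edges[OF XG] XG meet] by blast
    let ?Y = "?X - Z"
    have "Z \<noteq> ?X" using Z(1) False by auto
    then have Y: "?Y \<noteq> {}" using Z(2) by blast
    have ZY: "?X = Z \<union> ?Y" using Z(2) by auto
    have "int (card (I \<inter> Z)) \<le> k * int (card (V Z)) - l + capped_alpha D1"
      using Z(2) by (intro indep_Int_card_le_conn[OF I E' _ conn_setsD(2)[OF Z(1)] D1(2,1)]) auto
    moreover have "int (card (I \<inter> ?Y)) \<le> k * int (card (V ?Y)) - l + capped_alpha D2"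
      by (rule indep_Int_card_le_conn[OF I E' _ Y D2(2,1)]) auto
    moreover have "k * int (card (V ?X)) = k * int (card (V Z)) + k * int (card (V ?Y))"
    proof -
      have "Z \<subseteq> arcs G" "?Y \<subseteq> arcs G" using Z(2) XG by auto
      from card_V_Un[OF this] show ?thesis unfolding Z(3) ZY[symmetric] by simp
    qed
    moreover have "k * int (card (V ?X)) \<le> k * int (card ?W)"
      using card_mono[OF finW XW] k_ge_1 by (intro mult_left_mono) auto
    moreover note card_Int_Un_le[OF finite_edges[OF XG] ZY, of I]
    ultimately show ?thesis using U by linarith
  qed
  then show ?thesis using card_V_Un[OF G1 G2] unfolding f_eq by linarith
qed

section \<open>The matroid\<close>

lemma indep_mono: "indep I \<Longrightarrow> J \<subseteq> I \<Longrightarrow> indep J"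
  unfolding indep_iff by blast

lemma indep_matroid_loopless:
  assumes "indep I"
  shows "matroid_loopless I"
proof -
  have "1 \<le> f {e}" if "e \<in> I" for e
    using assms that conn_sets_single[of e G] unfolding indep_iff by fastforce
  then show ?thesis using assms by (auto simp: matroid_loopless_def indep_iff)
qed

text \<open>
  If no edge of J can be added to I, each of them is covered by a connected set D that I fills up to
  \<open>f D\<close>. Such sets can be uncrossed, and J has at most \<open>f D\<close> edges in each.
\<close>

lemma indep_exchange:
  assumes I: "indep I" and J: "indep J" and less: "card I < card J"
  shows "\<exists>e\<in>J - I. indep (insert e I)"
proof (rule ccontr)
  assume max: "\<not> ?thesis"
  have IG: "I \<subseteq> arcs G" and JG: "J \<subseteq> arcs G" using I J by (auto simp: indep_iff)
  let ?E = "I \<union> J"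
  have E: "matroid_loopless ?E" using indep_matroid_loopless[OF I] indep_matroid_loopless[OF J] by (auto simp: matroid_loopless_def)
  define \<D> where "\<D> = {D \<in> conn_sets G. D \<subseteq> ?E \<and> f D \<le> int (card (I \<inter> D))}"
  have "card J \<le> card I"
  proof (rule card_le_of_uncrossing_cover[of I J \<D>])
    show "finite ?E" using IG JG finite_edges by auto
    show "D \<subseteq> ?E" if "D \<in> \<D>" for D using that by (simp add: \<D>_def)
    show "card (J \<inter> D) \<le> card (I \<inter> D)" if "D \<in> \<D>" for D
      using indep_Int_card_le_f[OF J E, of D] that by (simp add: \<D>_def)
  next
    fix D D' assume D: "D \<in> \<D>" and D': "D' \<in> \<D>" and meet: "D \<inter> D' \<noteq> {}"
    have conn: "D \<in> conn_sets G" "D' \<in> conn_sets G" and sub: "D \<subseteq> ?E" "D' \<subseteq> ?E"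
      and tight: "f D \<le> int (card (I \<inter> D))" "f D' \<le> int (card (I \<inter> D'))"
      using D D' by (auto simp: \<D>_def)
    have fin: "finite (I \<inter> D)" "finite (I \<inter> D')" using IG finite_edges by auto
    have "card (I \<inter> (D \<union> D')) + card (I \<inter> (D \<inter> D')) = card (I \<inter> D) + card (I \<inter> D')"
      using card_Un_Int[OF fin] by (simp add: Int_Un_distrib Int_ac)
    moreover have "int (card (I \<inter> (D \<inter> D'))) + f (D \<union> D') \<le> f D + f D'"
      by (rule uncross[OF I E conn(1) sub(1) conn(2) sub(2) meet])
    ultimately have "f (D \<union> D') \<le> int (card (I \<inter> (D \<union> D')))" using tight by linarith
    moreover have "D \<union> D' \<in> conn_sets G"
      using meet by (intro conn_sets_Un conn) (auto simp: edge_verts_def)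
    ultimately show "D \<union> D' \<in> \<D>" using sub by (simp add: \<D>_def)
  next
    show "J - I \<subseteq> \<Union>\<D>"
    proof
      fix e assume e: "e \<in> J - I"
      then have "\<not> indep (insert e I)" using max by blast
      then obtain F where F: "F \<in> conn_sets G" "F \<subseteq> insert e I" "f F < int (card F)"
        using IG JG e unfolding indep_iff by force
      have eF: "e \<in> F"
      proof (rule ccontr)
        assume "e \<notin> F"
        then have "F \<subseteq> I" using F(2) by auto
        then show False using I F(1,3) by (auto simp: indep_iff)
      qed
      have "I \<inter> F = F - {e}" using F(2) e by auto
      then have "card F = card (I \<inter> F) + 1"
        using card.remove[OF finite_edges[OF conn_setsD(1)[OF F(1)]] eF] by simp
      then have "F \<in> \<D>" using F e by (auto simp: \<D>_def)
      then show "e \<in> \<Union>\<D>" using eF by blast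
    qed
  qed
  with less show False by simp
qed

lemma matroid_indep_alpha: "matroid_indep (arcs G) (indep_alpha \<Gamma> G \<psi> \<alpha> k l)"
  unfolding matroid_indep_def
proof (intro conjI ballI allI impI)
  show "{} \<in> indep_alpha \<Gamma> G \<psi> \<alpha> k l" by (auto simp: indep_iff dest: conn_setsD(2))
  show "Y \<in> indep_alpha \<Gamma> G \<psi> \<alpha> k l" if "X \<in> indep_alpha \<Gamma> G \<psi> \<alpha> k l" "Y \<subseteq> X" for X Y
    using that by (rule indep_mono)
  show "\<exists>e\<in>Y - X. insert e X \<in> indep_alpha \<Gamma> G \<psi> \<alpha> k l"
    if "X \<in> indep_alpha \<Gamma> G \<psi> \<alpha> k l" "Y \<in> indep_alpha \<Gamma> G \<psi> \<alpha> k l" "card X < card Y" for X Y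
    using that by (rule indep_exchange)
qed (auto simp: indep_alpha_def)

end

theorem theorem1p2:
  fixes \<Gamma> :: "('g, 'm) monoid_scheme"
    and G :: "('a, 'b) pre_digraph"
    and \<psi> :: "'b \<Rightarrow> 'g"
    and \<alpha> :: "'g set \<Rightarrow> int"
    and k l :: int
  assumes "k \<ge> 1" and "0 \<le> l" and "l \<le> k + 1"
    and "labeled_graph \<Gamma> G \<psi>"
    and "\<And>X. X \<subseteq> carrier \<Gamma> \<Longrightarrow> \<alpha> X \<in> {0..l}"
    and "polymatroidal \<Gamma> \<alpha>" and "normalized \<Gamma> \<alpha>"
    and "\<And>H. subgroup H \<Gamma> \<Longrightarrow> \<Gamma>\<lparr>carrier := H\<rparr> \<cong> integer_mod_group 2 \<Longrightarrow> \<alpha> H \<le> k"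
  shows "matroid_indep (arcs G) (indep_alpha \<Gamma> G \<psi> \<alpha> k l)"
proof -
  interpret labeled_graph \<Gamma> G \<psi> by fact
  interpret count_data \<Gamma> G \<psi> \<alpha> k l by unfold_locales (use assms in auto)
  show ?thesis by (rule matroid_indep_alpha)
qed

end
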